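(* The reductions $\to_{\mathsf{bc}}$ and $\to_{\mathsf{ex}}$ are sound: for $R\in\{\to_{\mathsf{bc}},\to_{\mathsf{ex}}\}$, whenever $B\mathrel{R}C$ and $\Phi$ is an $\mathsf{SKS}$ derivation with associated atomic flow $B$, there is an $\mathsf{SKS}$ derivation $\Psi$ with associated atomic flow $C$ and with the same premiss and conclusion as $\Phi$.
   Context: Formulae are built from the units $\mathsf f$ and $\mathsf t$, atoms, disjunction $[\alpha\vee\beta]$ and conjunction $(\alpha\wedge\beta)$; on atoms there is an involution $a\mapsto\bar a$ with $\bar a\neq a$. An inference step of a rule $\alpha/\beta$ rewrites $\xi\{\alpha\}$ into $\xi\{\beta\}$ for an arbitrary context (formula with a hole) $\xi$. A derivation from $\alpha$ (premiss) to $\beta$ (conclusion) is a finite chain of steps from $\alpha$ to $\beta$. System $\mathsf{SKS}$: interaction $\mathsf t/[a\vee\bar a]$; weakening $\mathsf f/a$; contraction $[a\vee a]/a$; cut $(a\wedge\bar a)/\mathsf f$; coweakening $a/\mathsf t$; cocontraction $a/(a\wedge a)$; switch $(\alpha\wedge[\beta\vee\gamma])/[(\alpha\wedge\beta)\vee\gamma]$; medial $[(\alpha\wedge\beta)\vee(\gamma\wedge\delta)]/([\alpha\vee\gamma]\wedge[\beta\vee\delta])$; and $\gamma/\delta$ whenever $\gamma=\delta$ is (either direction of) an instance of commutativity or associativity of $\vee,\wedge$, $[\alpha\vee\mathsf f]=\alpha$, $(\alpha\wedge\mathsf t)=\alpha$, $[\mathsf t\vee\mathsf t]=\mathsf t$,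 $(\mathsf f\wedge\mathsf f)=\mathsf f$. An atomic flow is a tuple $(V,E,\eta,up,lo)$: finite vertex and edge sets, labels interaction, cut, weakening, coweakening, contraction, cocontraction, and maps $up:E\to V\cup\{\top\}$, $lo:E\to V\cup\{\bot\}$. Upper edges of $\nu$: $lo(\epsilon)=\nu$; lower edges: $up(\epsilon)=\nu$. (Upper, lower) edge numbers: $(0,2)$ interaction, $(2,0)$ cut, $(0,1)$ weakening, $(1,0)$ coweakening, $(2,1)$ contraction, $(1,2)$ cocontraction; no directed cycles; a sign map $\pi:E\to\{+,-\}$ exists giving all edges of a (co)contraction the same sign and the two edges of an interaction/cut different signs. Edges with $up=\top$ ($lo=\bot$) are the flow's upper (lower) edges. The atomic flow of an $\mathsf{SKS}$ derivation traces atom occurrences (occurrences in contexts and instantiated subformulae of switch, medial, $=$ keep their edge); each step of an atomic rule gives a vertex with that label, upper edges being the redex occurrences of the step's premiss and lower edges those of its conclusion; occurrences in the premiss/conclusion of the derivation have $up=\top$ / $lo=\bot$. Paths: a path is a sequence $\epsilon_1,\dots,\epsilon_h$ with $lo(\epsilon_i)=up(\epsilon_{i+1})$ (or its reversal); an $\mathsf{ai}$-path is a concatenation of paths $p_1,\dots,p_m$ where consecutive ones meet at an interaction or cut vertex with distinct edges at the junction; it is maximal if no $\mathsf{ai}$-path containing its edges is longer; an $\mathsf{ai}$-cycle is an $\mathsf{ai}$-path from a vertex to itself with no repeated edge; a fragile cycle is an $\mathsf{ai}$-cycle containing a simple edge (an edge from an interaction to a cut); an $\mathsf{ai}$-connection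 is a path between an interaction and a cut; a clean path is an $\mathsf{ai}$-path all of whose $\mathsf{ai}$-connections are simple edges; an extremal simple edge is an edge $\epsilon_k$ such that for some maximal $\mathsf{ai}$-path $\epsilon_1,\dots,\epsilon_h$ that is clean, $\epsilon_k$ is simple and $\epsilon_{k+1},\dots,\epsilon_h$ are not. Splitting and gluing: for a simple edge $\epsilon$ of $B$ from interaction $\iota$ to cut $\kappa$, let $\epsilon_2$ be $\iota$'s other lower edge, $\epsilon_3$ $\kappa$'s other upper edge, $A$ the flow obtained by deleting $\iota,\kappa,\epsilon$, and $\epsilon_1,\dots,\epsilon_h$, $\epsilon'_1,\dots,\epsilon'_k$ the other upper and lower edges of $A$. $B'$ is a copy $\tilde A$ of $A$ with $\tilde\epsilon_2$ made the lower edge of a new weakening; $B''$ is a copy $\hat A$ of $A$ with $\hat\epsilon_3$ made the upper edge of a new coweakening. For flows $D',D''$ whose upper/lower edges correspond one-to-one to those of $B',B''$, $\mathrm{Glue}(D',D'')$ identifies edge $\tilde\epsilon_3$ of $D'$ with edge $\hat\epsilon_2$ of $D''$ into one edge, adds for each $i$ a cocontraction with upper edge $\epsilon_i$ and lower edges $\tilde\epsilon_i,\hat\epsilon_i$, and for each $j$ a contraction with upper edges $\tilde\epsilon'_j,\hat\epsilon'_j$ and lower edge $\epsilon'_j$. $\to_{\mathsf{bc}}$: if $B$ has no fragile cycle then $B\to_{\mathsf{bc}}B$; if $\epsilon$ is a simple edge of $B$ lying on an $\mathsf{ai}$-cycle, $B'\to_{\mathsf{bc}}D'$ and $B''\to_{\mathsf{bc}}D''$,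 then $B\to_{\mathsf{bc}}\mathrm{Glue}(D',D'')$. $\to_{\mathsf{ex}}$: if $B$ has no extremal simple edge then $B\to_{\mathsf{ex}}B$; if $\epsilon$ is an extremal simple edge of $B$, $B'\to_{\mathsf{ex}}D'$ and $B''\to_{\mathsf{ex}}D''$, then $B\to_{\mathsf{ex}}\mathrm{Glue}(D',D'')$. *)

theory Defs
  imports Main
begin

datatype 'a fm = FF | TT | At 'a | Or "'a fm" "'a fm" | And "'a fm" "'a fm"

datatype 'a ctx = Hole | OrL "'a ctx" "'a fm" | OrR "'a fm" "'a ctx"
  | AndL "'a ctx" "'a fm" | AndR "'a fm" "'a ctx"

fun fill :: "'a ctx \<Rightarrow> 'a fm \<Rightarrow> 'a fm" where
  "fill Hole x = x"
| "fill (OrL c b) x = Or (fill c x) b"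
| "fill (OrR a c) x = Or a (fill c x)"
| "fill (AndL c b) x = And (fill c x) b"
| "fill (AndR a c) x = And a (fill c x)"

fun hpos :: "'a ctx \<Rightarrow> nat list" where
  "hpos Hole = []"
| "hpos (OrL c b) = 0 # hpos c"
| "hpos (OrR a c) = 1 # hpos c"
| "hpos (AndL c b) = 0 # hpos c"
| "hpos (AndR a c) = 1 # hpos c"

fun atpos :: "'a fm \<Rightarrow> nat list set" where
  "atpos (At a) = {[]}"
| "atpos (Or x y) = (Cons 0) ` atpos x \<union> (Cons 1) ` atpos y"
| "atpos (And x y) = (Cons 0) ` atpos x \<union> (Cons 1) ` atpos y"
| "atpos _ = {}"

datatype 'a inst =
    RI 'a | RW 'a | RC 'a | RCut 'a | RCw 'a | RCc 'a
  | RSw "'a fm" "'a fm" "'a fm"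
  | RMed "'a fm" "'a fm" "'a fm" "'a fm"
  | EOrComm "'a fm" "'a fm" | EAndComm "'a fm" "'a fm"
  | EOrAs1 "'a fm" "'a fm" "'a fm" | EOrAs2 "'a fm" "'a fm" "'a fm"
  | EAndAs1 "'a fm" "'a fm" "'a fm" | EAndAs2 "'a fm" "'a fm" "'a fm"
  | EOrU1 "'a fm" | EOrU2 "'a fm" | EAndU1 "'a fm" | EAndU2 "'a fm"
  | ETT1 | ETT2 | EFF1 | EFF2

fun prem :: "('a \<Rightarrow> 'a) \<Rightarrow> 'a inst \<Rightarrow> 'a fm" where
  "prem bar (RI a) = TT"
| "prem bar (RW a) = FF"
| "prem bar (RC a) = Or (At a) (At a)"
| "prem bar (RCut a) = And (At a) (At (bar a))"
| "prem bar (RCw a) = At a"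
| "prem bar (RCc a) = At a"
| "prem bar (RSw x y z) = And x (Or y z)"
| "prem bar (RMed x y z w) = Or (And x y) (And z w)"
| "prem bar (EOrComm x y) = Or x y"
| "prem bar (EAndComm x y) = And x y"
| "prem bar (EOrAs1 x y z) = Or (Or x y) z"
| "prem bar (EOrAs2 x y z) = Or x (Or y z)"
| "prem bar (EAndAs1 x y z) = And (And x y) z"
| "prem bar (EAndAs2 x y z) = And x (And y z)"
| "prem bar (EOrU1 x) = Or x FF"
| "prem bar (EOrU2 x) = x"
| "prem bar (EAndU1 x) = And x TT"
| "prem bar (EAndU2 x) = x"
| "prem bar ETT1 = Or TT TT"
| "prem bar ETT2 = TT"
| "prem bar EFF1 = And FF FF"
| "prem bar EFF2 = FF"

fun concl :: "('a \<Rightarrow> 'a) \<Rightarrow> 'a inst \<Rightarrow> 'a fm" where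
  "concl bar (RI a) = Or (At a) (At (bar a))"
| "concl bar (RW a) = At a"
| "concl bar (RC a) = At a"
| "concl bar (RCut a) = FF"
| "concl bar (RCw a) = TT"
| "concl bar (RCc a) = And (At a) (At a)"
| "concl bar (RSw x y z) = Or (And x y) z"
| "concl bar (RMed x y z w) = And (Or x z) (Or y w)"
| "concl bar (EOrComm x y) = Or y x"
| "concl bar (EAndComm x y) = And y x"
| "concl bar (EOrAs1 x y z) = Or x (Or y z)"
| "concl bar (EOrAs2 x y z) = Or (Or x y) z"
| "concl bar (EAndAs1 x y z) = And x (And y z)"
| "concl bar (EAndAs2 x y z) = And (And x y) z"
| "concl bar (EOrU1 x) = x"
| "concl bar (EOrU2 x) = Or x FF"
| "concl bar (EAndU1 x) = x"
| "concl bar (EAndU2 x) = And x TT"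
| "concl bar ETT1 = TT"
| "concl bar ETT2 = Or TT TT"
| "concl bar EFF1 = FF"
| "concl bar EFF2 = And FF FF"

text \<open>For the non-atomic rules: position of each instantiated subformula (schematic
  variable) in the premiss redex and in the conclusion redex.  Atom occurrences
  inside them keep their edge.\<close>

fun vmap :: "'a inst \<Rightarrow> (nat list \<times> nat list) list" where
  "vmap (RSw x y z) = [([0],[0,0]), ([1,0],[0,1]), ([1,1],[1])]"
| "vmap (RMed x y z w) = [([0,0],[0,0]), ([0,1],[1,0]), ([1,0],[0,1]), ([1,1],[1,1])]"
| "vmap (EOrComm x y) = [([0],[1]), ([1],[0])]"
| "vmap (EAndComm x y) = [([0],[1]), ([1],[0])]"
| "vmap (EOrAs1 x y z) = [([0,0],[0]), ([0,1],[1,0]), ([1],[1,1])]"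
| "vmap (EOrAs2 x y z) = [([0],[0,0]), ([1,0],[0,1]), ([1,1],[1])]"
| "vmap (EAndAs1 x y z) = [([0,0],[0]), ([0,1],[1,0]), ([1],[1,1])]"
| "vmap (EAndAs2 x y z) = [([0],[0,0]), ([1,0],[0,1]), ([1,1],[1])]"
| "vmap (EOrU1 x) = [([0],[])]"
| "vmap (EOrU2 x) = [([],[0])]"
| "vmap (EAndU1 x) = [([0],[])]"
| "vmap (EAndU2 x) = [([],[0])]"
| "vmap _ = []"

fun atomic :: "'a inst \<Rightarrow> bool" where
  "atomic (RI a) = True" | "atomic (RW a) = True" | "atomic (RC a) = True"
| "atomic (RCut a) = True" | "atomic (RCw a) = True" | "atomic (RCc a) = True"
| "atomic _ = False"

datatype lbl = LInt | LCut | LW | LCw | LCtr | LCc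

text \<open>fup/flo: None stands for the top (resp. bottom) marker.\<close>

record ('v, 'e) flow =
  fV :: "'v set"
  fE :: "'e set"
  flab :: "'v \<Rightarrow> lbl"
  fup :: "'e \<Rightarrow> 'v option"
  flo :: "'e \<Rightarrow> 'v option"

fun lblof :: "'a inst \<Rightarrow> lbl" where
  "lblof (RI a) = LInt" | "lblof (RW a) = LW" | "lblof (RC a) = LCtr"
| "lblof (RCut a) = LCut" | "lblof (RCw a) = LCw" | "lblof (RCc a) = LCc"
| "lblof _ = LInt"

fun derivation :: "('a \<Rightarrow> 'a) \<Rightarrow> 'a fm \<Rightarrow> ('a ctx \<times> 'a inst) list \<Rightarrow> bool" where
  "derivation bar x [] = True"
| "derivation bar x ((c, r) # ss) =
     (fill c (prem bar r) = x \<and> derivation bar (fill c (concl bar r)) ss)"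

fun fmls :: "('a \<Rightarrow> 'a) \<Rightarrow> 'a fm \<Rightarrow> ('a ctx \<times> 'a inst) list \<Rightarrow> 'a fm list" where
  "fmls bar x [] = [x]"
| "fmls bar x ((c, r) # ss) = x # fmls bar (fill c (concl bar r)) ss"

definition dconcl :: "('a \<Rightarrow> 'a) \<Rightarrow> 'a fm \<Rightarrow> ('a ctx \<times> 'a inst) list \<Rightarrow> 'a fm" where
  "dconcl bar x ss = last (fmls bar x ss)"

text \<open>Tracing an atom occurrence across one step; None if it is consumed by an
  atomic rule.\<close>

definition tr :: "'a ctx \<times> 'a inst \<Rightarrow> nat list \<Rightarrow> nat list option" where
  "tr s p = (let h = hpos (fst s) in
     if take (length h) p = h then
       (let p' = drop (length h) p in
        case find (\<lambda>(a, b). take (length a) p' = a) (vmap (snd s)) of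
          Some (a, b) \<Rightarrow> Some (h @ b @ drop (length a) p')
        | None \<Rightarrow> None)
     else Some p)"

text \<open>The first occurrence of the edge containing occurrence p of the k-th formula.\<close>

fun src :: "'a fm list \<Rightarrow> ('a ctx \<times> 'a inst) list \<Rightarrow> nat \<Rightarrow> nat list \<Rightarrow> nat \<times> nat list" where
  "src fs ss 0 p = (0, p)"
| "src fs ss (Suc k) p =
     (if \<exists>q \<in> atpos (fs ! k). tr (ss ! k) q = Some p
      then src fs ss k (THE q. q \<in> atpos (fs ! k) \<and> tr (ss ! k) q = Some p)
      else (Suc k, p))"

definition dflow :: "('a \<Rightarrow> 'a) \<Rightarrow> 'a fm \<Rightarrow> ('a ctx \<times> 'a inst) list
    \<Rightarrow> (nat, nat \<times> nat list) flow" where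
  "dflow bar x ss = (let fs = fmls bar x ss; n = length ss;
     cons = (\<lambda>e k. \<exists>p. k < n \<and> p \<in> atpos (fs ! k) \<and> src fs ss k p = e \<and> tr (ss ! k) p = None) in
   \<lparr> fV = {k. k < n \<and> atomic (snd (ss ! k))},
     fE = {src fs ss k p | k p. k \<le> n \<and> p \<in> atpos (fs ! k)},
     flab = (\<lambda>k. lblof (snd (ss ! k))),
     fup = (\<lambda>e. if fst e = 0 then None else Some (fst e - 1)),
     flo = (\<lambda>e. if \<exists>k. cons e k then Some (THE k. cons e k) else None) \<rparr>)"

definition flow_iso :: "('v, 'e) flow \<Rightarrow> ('w, 'f) flow \<Rightarrow> bool" where
  "flow_iso F G \<longleftrightarrow> (\<exists>fv fe. bij_betw fv (fV F) (fV G) \<and> bij_betw fe (fE F) (fE G)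
     \<and> (\<forall>v \<in> fV F. flab G (fv v) = flab F v)
     \<and> (\<forall>e \<in> fE F. fup G (fe e) = map_option fv (fup F e)
                  \<and> flo G (fe e) = map_option fv (flo F e)))"

text \<open>An ai-path is represented as a walk: a list of edges each with a direction
  (True = traversed downwards).  Consecutive edges of the same direction form a path;
  a change of direction happens at an interaction (going up then down through its two
  distinct lower edges) or at a cut (going down then up through its two distinct upper
  edges).\<close>

definition entry :: "('v, 'e) flow \<Rightarrow> 'e \<times> bool \<Rightarrow> 'v option" where
  "entry F x = (if snd x then fup F (fst x) else flo F (fst x))"

definition exit :: "('v, 'e) flow \<Rightarrow> 'e \<times> bool \<Rightarrow> 'v option" where
  "exit F x = (if snd x then flo F (fst x) else fup F (fst x))"

definition step_ok :: "('v, 'e) flow \<Rightarrow> 'e \<times> bool \<Rightarrow> 'e \<times> bool \<Rightarrow> bool" where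
  "step_ok F x y \<longleftrightarrow> (\<exists>v \<in> fV F. exit F x = Some v \<and> entry F y = Some v \<and>
     (snd x = snd y \<or>
      (fst x \<noteq> fst y \<and> ((snd x \<and> \<not> snd y \<and> flab F v = LCut) \<or>
                          (\<not> snd x \<and> snd y \<and> flab F v = LInt)))))"

definition aipath :: "('v, 'e) flow \<Rightarrow> ('e \<times> bool) list \<Rightarrow> bool" where
  "aipath F w \<longleftrightarrow> w \<noteq> [] \<and> fst ` set w \<subseteq> fE F \<and>
     (\<forall>i. Suc i < length w \<longrightarrow> step_ok F (w ! i) (w ! Suc i))"

definition aicycle :: "('v, 'e) flow \<Rightarrow> ('e \<times> bool) list \<Rightarrow> bool" where
  "aicycle F w \<longleftrightarrow> aipath F w \<and> distinct (map fst w) \<and>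
     (\<exists>v. entry F (hd w) = Some v \<and> exit F (last w) = Some v)"

definition simple_edge :: "('v, 'e) flow \<Rightarrow> 'e \<Rightarrow> bool" where
  "simple_edge F e \<longleftrightarrow> e \<in> fE F \<and> (\<exists>i k. fup F e = Some i \<and> flo F e = Some k \<and>
     flab F i = LInt \<and> flab F k = LCut)"

definition has_fragile :: "('v, 'e) flow \<Rightarrow> bool" where
  "has_fragile F \<longleftrightarrow> (\<exists>w. aicycle F w \<and> (\<exists>x \<in> set w. simple_edge F (fst x)))"

definition on_aicycle :: "('v, 'e) flow \<Rightarrow> 'e \<Rightarrow> bool" where
  "on_aicycle F e \<longleftrightarrow> (\<exists>w. aicycle F w \<and> e \<in> fst ` set w)"

text \<open>A monotone segment from the i-th to the j-th edge of a walk connecting an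
  interaction and a cut (an ai-connection).\<close>

definition aiconn :: "('v, 'e) flow \<Rightarrow> 'e \<times> bool \<Rightarrow> 'e \<times> bool \<Rightarrow> bool" where
  "aiconn F x y \<longleftrightarrow> (\<exists>i k. flab F i = LInt \<and> flab F k = LCut \<and>
     ((snd x \<and> fup F (fst x) = Some i \<and> flo F (fst y) = Some k) \<or>
      (\<not> snd x \<and> flo F (fst x) = Some k \<and> fup F (fst y) = Some i)))"

definition clean :: "('v, 'e) flow \<Rightarrow> ('e \<times> bool) list \<Rightarrow> bool" where
  "clean F w \<longleftrightarrow> aipath F w \<and>
     (\<forall>i j. i \<le> j \<and> j < length w \<and> (\<forall>k. i \<le> k \<and> k \<le> j \<longrightarrow> snd (w ! k) = snd (w ! i))
        \<and> aiconn F (w ! i) (w ! j) \<longrightarrow> i = j \<and> simple_edge F (fst (w ! i)))"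

definition maximal :: "('v, 'e) flow \<Rightarrow> ('e \<times> bool) list \<Rightarrow> bool" where
  "maximal F w \<longleftrightarrow> aipath F w \<and>
     (\<forall>w'. aipath F w' \<and> fst ` set w \<subseteq> fst ` set w' \<longrightarrow> length w' \<le> length w)"

definition extremal :: "('v, 'e) flow \<Rightarrow> 'e \<Rightarrow> bool" where
  "extremal F e \<longleftrightarrow> (\<exists>w k. maximal F w \<and> clean F w \<and> k < length w \<and> fst (w ! k) = e \<and>
     simple_edge F e \<and> (\<forall>l. k < l \<and> l < length w \<longrightarrow> \<not> simple_edge F (fst (w ! l))))"

datatype nm = Nb nat | Tl nm | Ht nm | Lf nm | Rt nm | Nw | Ncw
  | Ncc nm | Nct nm | NU nm | NL nm

definition ren :: "('v \<Rightarrow> 'w) \<Rightarrow> ('e \<Rightarrow> 'f) \<Rightarrow> ('v, 'e) flow \<Rightarrow> ('w, 'f) flow" where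
  "ren fv fe F = \<lparr> fV = fv ` fV F, fE = fe ` fE F, flab = (\<lambda>w. flab F (inv fv w)),
     fup = (\<lambda>e. map_option fv (fup F (inv fe e))),
     flo = (\<lambda>e. map_option fv (flo F (inv fe e))) \<rparr>"

definition e2_of :: "('v, 'e) flow \<Rightarrow> 'e \<Rightarrow> 'e" where
  "e2_of B e = (THE x. x \<in> fE B \<and> x \<noteq> e \<and> fup B x = fup B e)"

definition e3_of :: "('v, 'e) flow \<Rightarrow> 'e \<Rightarrow> 'e" where
  "e3_of B e = (THE x. x \<in> fE B \<and> x \<noteq> e \<and> flo B x = flo B e)"

definition delA :: "('v, 'e) flow \<Rightarrow> 'e \<Rightarrow> ('v, 'e) flow" where
  "delA B e = \<lparr> fV = fV B - {the (fup B e), the (flo B e)}, fE = fE B - {e}, flab = flab B,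
     fup = (\<lambda>x. if fup B x = fup B e then None else fup B x),
     flo = (\<lambda>x. if flo B x = flo B e then None else flo B x) \<rparr>"

definition splitL :: "(nm, nm) flow \<Rightarrow> nm \<Rightarrow> (nm, nm) flow" where
  "splitL B e = (let A = ren Tl Tl (delA B e) in
     A\<lparr> fV := insert Nw (fV A), flab := (flab A)(Nw := LW),
        fup := (fup A)(Tl (e2_of B e) := Some Nw) \<rparr>)"

definition splitR :: "(nm, nm) flow \<Rightarrow> nm \<Rightarrow> (nm, nm) flow" where
  "splitR B e = (let A = ren Ht Ht (delA B e) in
     A\<lparr> fV := insert Ncw (fV A), flab := (flab A)(Ncw := LCw),
        flo := (flo A)(Ht (e3_of B e) := Some Ncw) \<rparr>)"

definition upper :: "('v, 'e) flow \<Rightarrow> 'e set" where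
  "upper F = {x \<in> fE F. fup F x = None}"

definition lower :: "('v, 'e) flow \<Rightarrow> 'e set" where
  "lower F = {x \<in> fE F. flo F x = None}"

text \<open>Gluing.  The maps fu1, fl1 (fu2, fl2) send the upper, resp. lower, edges of
  splitL B e (splitR B e) to the corresponding upper, resp. lower, edges of D1 (D2).
  An upper (lower) edge x of B becomes the new edge NU x (NL x) of the glued flow, the
  upper (lower) edge of a new cocontraction Ncc x (contraction Nct x).\<close>

definition glue :: "(nm, nm) flow \<Rightarrow> nm \<Rightarrow> (nm, nm) flow \<Rightarrow> (nm \<Rightarrow> nm) \<Rightarrow> (nm \<Rightarrow> nm)
    \<Rightarrow> (nm, nm) flow \<Rightarrow> (nm \<Rightarrow> nm) \<Rightarrow> (nm \<Rightarrow> nm) \<Rightarrow> (nm, nm) flow" where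
  "glue B e D1 fu1 fl1 D2 fu2 fl2 = (let
     g3 = fl1 (Tl (e3_of B e)); g2 = fu2 (Ht (e2_of B e));
     up1 = (\<lambda>x. case fup D1 x of Some v \<Rightarrow> Some (Lf v)
                 | None \<Rightarrow> Some (Ncc (THE y. y \<in> upper B \<and> fu1 (Tl y) = x)));
     lo1 = (\<lambda>x. case flo D1 x of Some v \<Rightarrow> Some (Lf v)
                 | None \<Rightarrow> Some (Nct (THE y. y \<in> lower B \<and> fl1 (Tl y) = x)));
     up2 = (\<lambda>x. case fup D2 x of Some v \<Rightarrow> Some (Rt v)
                 | None \<Rightarrow> Some (Ncc (THE y. y \<in> upper B \<and> fu2 (Ht y) = x)));
     lo2 = (\<lambda>x. case flo D2 x of Some v \<Rightarrow> Some (Rt v)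
                 | None \<Rightarrow> Some (Nct (THE y. y \<in> lower B \<and> fl2 (Ht y) = x)))
   in \<lparr> fV = Lf ` fV D1 \<union> Rt ` fV D2 \<union> Ncc ` upper B \<union> Nct ` lower B,
        fE = Lf ` fE D1 \<union> Rt ` (fE D2 - {g2}) \<union> NU ` upper B \<union> NL ` lower B,
        flab = (\<lambda>v. case v of Lf u \<Rightarrow> flab D1 u | Rt u \<Rightarrow> flab D2 u
                     | Ncc u \<Rightarrow> LCc | Nct u \<Rightarrow> LCtr | _ \<Rightarrow> LInt),
        fup = (\<lambda>x. case x of Lf y \<Rightarrow> up1 y | Rt y \<Rightarrow> up2 y
                     | NU y \<Rightarrow> None | NL y \<Rightarrow> Some (Nct y) | _ \<Rightarrow> None),
        flo = (\<lambda>x. case x of Lf y \<Rightarrow> (if y = g3 then lo2 g2 else lo1 y) | Rt y \<Rightarrow> lo2 y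
                     | NU y \<Rightarrow> Some (Ncc y) | NL y \<Rightarrow> None | _ \<Rightarrow> None) \<rparr>)"

text \<open>red_bc B C fu fl: B reduces to C, where fu (fl) maps each upper (lower) edge of B
  to the corresponding upper (lower) edge of C.\<close>

inductive red_bc :: "(nm, nm) flow \<Rightarrow> (nm, nm) flow \<Rightarrow> (nm \<Rightarrow> nm) \<Rightarrow> (nm \<Rightarrow> nm) \<Rightarrow> bool" where
  bc_base: "\<not> has_fragile B \<Longrightarrow> red_bc B B id id"
| bc_step: "simple_edge B e \<Longrightarrow> on_aicycle B e \<Longrightarrow>
    red_bc (splitL B e) D1 fu1 fl1 \<Longrightarrow> red_bc (splitR B e) D2 fu2 fl2 \<Longrightarrow>
    red_bc B (glue B e D1 fu1 fl1 D2 fu2 fl2) NU NL"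

inductive red_ex :: "(nm, nm) flow \<Rightarrow> (nm, nm) flow \<Rightarrow> (nm \<Rightarrow> nm) \<Rightarrow> (nm \<Rightarrow> nm) \<Rightarrow> bool" where
  ex_base: "\<not> (\<exists>e. extremal B e) \<Longrightarrow> red_ex B B id id"
| ex_step: "extremal B e \<Longrightarrow>
    red_ex (splitL B e) D1 fu1 fl1 \<Longrightarrow> red_ex (splitR B e) D2 fu2 fl2 \<Longrightarrow>
    red_ex B (glue B e D1 fu1 fl1 D2 fu2 fl2) NU NL"

definition to_bc :: "(nm, nm) flow \<Rightarrow> (nm, nm) flow \<Rightarrow> bool" where
  "to_bc B C \<longleftrightarrow> (\<exists>fu fl. red_bc B C fu fl)"

definition to_ex :: "(nm, nm) flow \<Rightarrow> (nm, nm) flow \<Rightarrow> bool" where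
  "to_ex B C \<longleftrightarrow> (\<exists>fu fl. red_ex B C fu fl)"

end

theory Submission
  imports Defs "HOL-Library.Multiset"
begin

text \<open>
  Atom occurrences are decorated with the name of the edge they belong to. A decorated derivation
  then determines its flow through the list of its atomic steps, and a flow is associated with a
  derivation iff the derivation can be decorated with the edges of that flow; so both reductions
  can be followed on decorated derivations, and only the simplicity of the chosen edge matters.

  Let a simple edge carry the atom \<open>a\<close> from an interaction to a cut in a derivation from
  \<open>\<alpha>\<close> to \<open>\<beta>\<close>. Replacing \<open>a\<close> along the edge by \<open>t\<close>, the interaction becomes a weakening
  and the cut leaves \<open>(t \<and> a')\<close>, with \<open>a'\<close> the dual of \<open>a\<close>, which switches move out of its
  context: this is a derivation from \<open>\<alpha>\<close> to \<open>[\<beta> \<or> a']\<close>. Replacing \<open>a\<close> by \<open>f\<close> gives dually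
  a derivation from \<open>(\<alpha> \<and> a')\<close> to \<open>\<beta>\<close>. After these have been reduced, gluing is the chain
  \<open>\<alpha> / (\<alpha> \<and> \<alpha>) / ([\<beta> \<or> a'] \<and> \<alpha>) / [\<beta> \<or> (\<alpha> \<and> a')] / [\<beta> \<or> \<beta>] / \<beta>\<close>.
\<close>

section \<open>Labelled derivations\<close>

text \<open>Edges of \<open>dflow\<close> are named by a formula number and a position, and
  inserting a step shifts all these names. Decorations avoid this: positions are handled once, where
  \<open>dflow\<close> is shown to be realized by a decoration of its own derivation; afterwards
  edges are mere names that can be renamed at will. A simple edge is tractable because it meets only
  structural steps between its interaction and its cut, and those are schematic in formulae, so that
  a unit may take the place of the atom. Induction along a reduction cannot keep premiss and
  conclusion fixed, since the left part has one more atom in its conclusion and the right part one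
  more in its premiss. Soundness is therefore stated for every decorated derivation of the flow,
  together with maps telling which edge of the reduct stands at each occurrence of premiss and
  conclusion. Without these maps the two reduced parts could not be joined occurrence by occurrence,
  nor could the edge shared between them be found.\<close>

fun atoms :: "'x fm \<Rightarrow> 'x list" where
  "atoms (At a) = [a]"
| "atoms (Or x y) = atoms x @ atoms y"
| "atoms (And x y) = atoms x @ atoms y"
| "atoms _ = []"

fun ctx_atoms :: "'x ctx \<Rightarrow> 'x list" where
  "ctx_atoms Hole = []"
| "ctx_atoms (OrL c b) = ctx_atoms c @ atoms b"
| "ctx_atoms (OrR a c) = atoms a @ ctx_atoms c"
| "ctx_atoms (AndL c b) = ctx_atoms c @ atoms b"
| "ctx_atoms (AndR a c) = atoms a @ ctx_atoms c"

abbreviation labs :: "('a \<times> 'e) fm \<Rightarrow> 'e list" where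
  "labs X \<equiv> map snd (atoms X)"

abbreviation ctx_labs :: "('a \<times> 'e) ctx \<Rightarrow> 'e list" where
  "ctx_labs c \<equiv> map snd (ctx_atoms c)"

abbreviation relab :: "('e \<Rightarrow> 'f) \<Rightarrow> ('a \<times> 'e) fm \<Rightarrow> ('a \<times> 'f) fm" where
  "relab g \<equiv> map_fm (apsnd g)"

text \<open>An event is a vertex with its label, its upper edges and its lower edges.\<close>

type_synonym ('v, 'e) event = "'v \<times> lbl \<times> 'e list \<times> 'e list"

definition ins :: "('v, 'e) event list \<Rightarrow> 'e list" where
  "ins es = concat (map (\<lambda>(v, l, i, out). i) es)"

definition outs :: "('v, 'e) event list \<Rightarrow> 'e list" where
  "outs es = concat (map (\<lambda>(v, l, i, out). out) es)"

definition relab_event :: "('v \<Rightarrow> 'w) \<Rightarrow> ('e \<Rightarrow> 'f) \<Rightarrow> ('v, 'e) event \<Rightarrow> ('w, 'f) event" where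
  "relab_event h g = (\<lambda>(v, l, i, out). (h v, l, map g i, map g out))"

lemma ins_simps [simp]:
  "ins [] = []" "ins ((v, l, i, out) # es) = i @ ins es" "ins (es @ es') = ins es @ ins es'"
  by (auto simp: ins_def)

lemma outs_simps [simp]:
  "outs [] = []" "outs ((v, l, i, out) # es) = out @ outs es"
  "outs (es @ es') = outs es @ outs es'"
  by (auto simp: outs_def)

lemma relab_event_simp [simp]: "relab_event h g (v, l, i, out) = (h v, l, map g i, map g out)"
  by (simp add: relab_event_def)

lemma ins_relab [simp]: "ins (map (relab_event h g) es) = map g (ins es)"
  by (induction es) auto

lemma outs_relab [simp]: "outs (map (relab_event h g) es) = map g (outs es)"
  by (induction es) auto

lemma fst_relab_event [simp]: "fst (relab_event h g ev) = h (fst ev)"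
  by (cases ev) auto

lemma atoms_map_fm [simp]: "atoms (map_fm f X) = map f (atoms X)"
  by (induction X) auto

lemma map_fm_fill [simp]: "map_fm f (fill c X) = fill (map_ctx f c) (map_fm f X)"
  by (induction c) auto

lemma mset_atoms_fill: "mset (atoms (fill c X)) = mset (ctx_atoms c) + mset (atoms X)"
  by (induction c) auto

lemma mset_labs_fill: "mset (labs (fill c X)) = mset (ctx_labs c) + mset (labs X)"
  using mset_atoms_fill[of c X] by (metis image_mset_union mset_map)

lemma set_atoms_fill: "set (atoms (fill c X)) = set (ctx_atoms c) \<union> set (atoms X)"
  using mset_atoms_fill[of c X] by (metis set_mset_mset set_mset_union)

lemma relab_relab [simp]: "relab g (relab f X) = relab (\<lambda>e. g (f e)) X"
  by (induction X) auto

lemma map_fst_relab [simp]: "map_fm fst (relab g X) = map_fm fst X"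
  by (simp add: fm.map_comp comp_def)

lemma map_ctx_fst_relab [simp]: "map_ctx fst (map_ctx (apsnd g) c) = map_ctx fst c"
  by (simp add: ctx.map_comp comp_def)

lemma map_inst_fst_relab [simp]: "map_inst fst (map_inst (apsnd g) r) = map_inst fst r"
  by (simp add: inst.map_comp comp_def)

lemma set_atoms [simp]: "set (atoms X) = set_fm X"
  by (induction X) auto

lemma set_ctx_atoms [simp]: "set (ctx_atoms X) = set_ctx X"
  by (induction X) auto

lemma relab_cong: "(\<And>e. e \<in> set (labs X) \<Longrightarrow> f e = g e) \<Longrightarrow> relab f X = relab g X"
  by (rule fm.map_cong) force+

lemma ctx_relab_cong:
  "(\<And>e. e \<in> set (ctx_labs c) \<Longrightarrow> f e = g e) \<Longrightarrow> map_ctx (apsnd f) c = map_ctx (apsnd g) c"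
  by (rule ctx.map_cong) force+

lemma relab_id [simp]: "relab id X = X"
  by (induction X) auto

lemma atomic_map_inst [simp]: "atomic (map_inst f r) = atomic r"
  by (cases r) auto

lemma prem_map_inst: "\<not> atomic r \<Longrightarrow> prem b (map_inst f r) = map_fm f (prem b' r)"
  by (cases r) auto

lemma concl_map_inst: "\<not> atomic r \<Longrightarrow> concl b (map_inst f r) = map_fm f (concl b' r)"
  by (cases r) auto

lemma mset_atoms_prem: "\<not> atomic r \<Longrightarrow> mset (atoms (prem b r)) = mset (atoms (concl b r))"
  by (cases r) auto

text \<open>The structural rules do not mention the involution, so \<open>id\<close> stands in for the one that
  decorated atoms lack.\<close>

inductive lstep :: "('a \<Rightarrow> 'a) \<Rightarrow> 'a ctx \<times> 'a inst \<Rightarrow> ('a \<times> 'e) fm \<Rightarrow> ('v, 'e) event list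
    \<Rightarrow> ('a \<times> 'e) fm \<Rightarrow> bool" for bar where
  lstep_struct: "\<not> atomic r \<Longrightarrow>
    lstep bar (map_ctx fst c, map_inst fst r) (fill c (prem id r)) [] (fill c (concl id r))"
| lstep_atomic: "atomic r \<Longrightarrow> map_fm fst P = prem bar r \<Longrightarrow> map_fm fst Q = concl bar r \<Longrightarrow>
    lstep bar (map_ctx fst c, r) (fill c P) [(v, lblof r, labs P, labs Q)] (fill c Q)"

text \<open>The plain step list stays visible as an index, because uniqueness of the flow compares
  two decorations of one and the same derivation.\<close>

inductive lder :: "('a \<Rightarrow> 'a) \<Rightarrow> ('a ctx \<times> 'a inst) list \<Rightarrow> ('a \<times> 'e) fm
    \<Rightarrow> ('v, 'e) event list \<Rightarrow> ('a \<times> 'e) fm \<Rightarrow> bool" for bar where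
  lder_Nil: "lder bar [] X [] X"
| lder_Cons: "lstep bar s X es Z \<Longrightarrow> lder bar ss Z es' Y \<Longrightarrow> lder bar (s # ss) X (es @ es') Y"

lemma lder_append: "lder bar ss X es Z \<Longrightarrow> lder bar ss' Z es' Y \<Longrightarrow> lder bar (ss @ ss') X (es @ es') Y"
  by (induction rule: lder.induct) (auto intro: lder_Cons simp: append_assoc)

lemma lder_snoc:
  assumes "lder bar ss X es Z" "lstep bar s Z es' Y"
  shows "lder bar (ss @ [s]) X (es @ es') Y"
  using lder_append[OF assms(1) lder_Cons[OF assms(2) lder_Nil]] by simp

text \<open>Structural steps and contexts only move occurrences, while an event trades its upper
  edges for its lower ones. The balance is additive, so that no multiset subtraction occurs.\<close>

lemma lstep_conserve: "lstep bar s X es Y \<Longrightarrow>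
    mset (labs X) + mset (outs es) = mset (labs Y) + mset (ins es)"
  by (induction rule: lstep.induct) (simp_all add: mset_atoms_fill mset_atoms_prem)

lemma lder_conserve: "lder bar ss X es Y \<Longrightarrow>
    mset (labs X) + mset (outs es) = mset (labs Y) + mset (ins es)"
proof (induction rule: lder.induct)
  case (lder_Cons s X es Z ss es' Y)
  then show ?case using lstep_conserve[OF lder_Cons(1)]
    by (simp add: ac_simps)
qed simp

lemma lstep_derivation: "lstep bar s X es Y \<Longrightarrow>
    fill (fst s) (prem bar (snd s)) = map_fm fst X \<and> fill (fst s) (concl bar (snd s)) = map_fm fst Y"
  by (induction rule: lstep.induct)
     (auto simp: prem_map_inst[where b' = id] concl_map_inst[where b' = id])

lemma dconcl_simps [simp]:
  "dconcl bar x [] = x"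
  "dconcl bar x ((c, r) # ss) = dconcl bar (fill c (concl bar r)) ss"
proof -
  have "fmls bar y ss \<noteq> []" for y by (cases ss) auto
  then show "dconcl bar x ((c, r) # ss) = dconcl bar (fill c (concl bar r)) ss"
    by (simp add: dconcl_def)
qed (simp add: dconcl_def)

lemma lder_derivation: "lder bar ss X es Y \<Longrightarrow>
    derivation bar (map_fm fst X) ss \<and> dconcl bar (map_fm fst X) ss = map_fm fst Y"
proof (induction rule: lder.induct)
  case (lder_Cons s X es Z ss es' Y)
  then show ?case using lstep_derivation[OF lder_Cons(1)] by (cases s) auto
qed simp

lemma lstep_relab: "lstep bar s X es Y \<Longrightarrow>
    lstep bar s (relab g X) (map (relab_event h g) es) (relab g Y)"
proof (induction rule: lstep.induct)
  case (lstep_struct r c)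
  then show ?case
    using lstep.lstep_struct[of "map_inst (apsnd g) r" bar "map_ctx (apsnd g) c"]
    by (simp add: prem_map_inst[where b' = id] concl_map_inst[where b' = id])
next
  case (lstep_atomic r P Q c v)
  then show ?case
    using lstep.lstep_atomic[of r "relab g P" bar "relab g Q" "map_ctx (apsnd g) c" "h v"]
    by (simp add: comp_def)
qed

lemma lder_relab: "lder bar ss X es Y \<Longrightarrow>
    lder bar ss (relab g X) (map (relab_event h g) es) (relab g Y)"
  by (induction rule: lder.induct) (auto intro: lder.intros lstep_relab)

text \<open>Every edge starts exactly once, either in the premiss or below an event. That it also ends
  exactly once follows, since structural steps permute the edges.\<close>

definition realizes :: "('v, 'e) flow \<Rightarrow> ('a \<times> 'e) fm \<Rightarrow> ('v, 'e) event list \<Rightarrow> ('a \<times> 'e) fm \<Rightarrow> bool"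
  where "realizes F X es Y \<longleftrightarrow>
    distinct (map fst es) \<and> fV F = set (map fst es) \<and>
    distinct (labs X @ outs es) \<and> fE F = set (labs X @ outs es) \<and>
    (\<forall>(v, l, i, out) \<in> set es. flab F v = l \<and> (\<forall>e \<in> set i. flo F e = Some v) \<and>
       (\<forall>e \<in> set out. fup F e = Some v)) \<and>
    (\<forall>e \<in> set (labs X). fup F e = None) \<and> (\<forall>e \<in> set (labs Y). flo F e = None)"

lemma lder_labels:
  assumes "lder bar ss X es Y"
  shows "set (labs X) \<union> set (outs es) = set (labs Y) \<union> set (ins es)"
    "distinct (labs X @ outs es) \<longleftrightarrow> distinct (labs Y @ ins es)"
proof -
  have *: "mset (labs X @ outs es) = mset (labs Y @ ins es)"
    using lder_conserve[OF assms] by simp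
  show "set (labs X) \<union> set (outs es) = set (labs Y) \<union> set (ins es)"
    using mset_eq_setD[OF *] by simp
  show "distinct (labs X @ outs es) \<longleftrightarrow> distinct (labs Y @ ins es)"
    using mset_eq_imp_distinct_iff[OF *] .
qed

lemma realizesD:
  assumes "realizes F X es Y"
  shows "distinct (map fst es)" "fV F = set (map fst es)"
    "distinct (labs X @ outs es)" "fE F = set (labs X @ outs es)"
    "e \<in> set (labs X) \<Longrightarrow> fup F e = None" "e \<in> set (labs Y) \<Longrightarrow> flo F e = None"
  using assms unfolding realizes_def by blast+

lemma realizes_event:
  assumes "realizes F X es Y" "(v, l, i, out) \<in> set es"
  shows "v \<in> fV F" "flab F v = l" "e \<in> set i \<Longrightarrow> flo F e = Some v"
    "e \<in> set out \<Longrightarrow> fup F e = Some v"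
proof -
  have "v \<in> set (map fst es)" using assms(2) by (metis fst_conv image_eqI set_map)
  then show "v \<in> fV F" using assms(1) by (simp only: realizes_def)
  have *: "\<forall>(v, l, i, out) \<in> set es. flab F v = l \<and> (\<forall>e \<in> set i. flo F e = Some v) \<and>
       (\<forall>e \<in> set out. fup F e = Some v)"
    using assms(1) unfolding realizes_def by (elim conjE)
  from bspec[OF this assms(2)]
  show "flab F v = l" "e \<in> set i \<Longrightarrow> flo F e = Some v" "e \<in> set out \<Longrightarrow> fup F e = Some v"
    by auto
qed

lemma in_outs: "e \<in> set (outs es) \<longleftrightarrow> (\<exists>v l i out. (v, l, i, out) \<in> set es \<and> e \<in> set out)"
  by (force simp: outs_def)

lemma in_ins: "e \<in> set (ins es) \<longleftrightarrow> (\<exists>v l i out. (v, l, i, out) \<in> set es \<and> e \<in> set i)"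
  by (force simp: ins_def)

section \<open>Decorated derivations and flow isomorphisms\<close>

text \<open>Every vertex has an event, and both ends of every edge are fixed by the premiss, the
  conclusion or an event, so the decoration determines the flow. The renamings are injective because
  the renamed lists still have no repetition.\<close>

lemma realizes_iso:
  assumes der: "lder bar ss X es Y" and "realizes F X es Y"
    and "realizes G (relab fe X) (map (relab_event fv fe) es) (relab fe Y)"
  shows "flow_iso F G"
  unfolding flow_iso_def
proof (intro exI[of _ fv] exI[of _ fe] conjI ballI)
  note F = realizesD[OF assms(2)] and G = realizesD[OF assms(3)]
  have vs: "map fst (map (relab_event fv fe) es) = map fv (map fst es)" by simp
  show "bij_betw fv (fV F) (fV G)"
    using F(1,2) G(1,2) unfolding vs by (metis bij_betw_def distinct_map set_map)
  have ls: "labs (relab fe X) @ outs (map (relab_event fv fe) es) = map fe (labs X @ outs es)"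
    by simp
  show "bij_betw fe (fE F) (fE G)"
    using F(3,4) G(3,4) unfolding ls by (metis bij_betw_def distinct_map set_map)
  note evF = realizes_event[OF assms(2)]
  have evG: "flab G (fv v) = l \<and> (\<forall>e \<in> set i. flo G (fe e) = Some (fv v))
      \<and> (\<forall>e \<in> set out. fup G (fe e) = Some (fv v))" if "(v, l, i, out) \<in> set es" for v l i out
  proof -
    have "(fv v, l, map fe i, map fe out) \<in> set (map (relab_event fv fe) es)"
      using that by (metis image_eqI relab_event_simp set_map)
    from realizes_event[OF assms(3) this] show ?thesis by auto
  qed
  show "flab G (fv v) = flab F v" if v: "v \<in> fV F" for v
  proof -
    obtain l i out where "(v, l, i, out) \<in> set es" using v F(2) by force
    then show ?thesis using evF evG by metis
  qed
  fix e assume e: "e \<in> fE F"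
  show "fup G (fe e) = map_option fv (fup F e)"
  proof (cases "e \<in> set (labs X)")
    case True
    then have "fe e \<in> set (labs (relab fe X))" by auto
    then show ?thesis using F(5)[OF True] G(5) by simp
  next
    case False
    then obtain v l i out where *: "(v, l, i, out) \<in> set es" "e \<in> set out"
      using e F(4) by (auto simp: in_outs)
    then show ?thesis using evF(4)[OF *] evG[OF *(1)] by simp
  qed
  show "flo G (fe e) = map_option fv (flo F e)"
  proof (cases "e \<in> set (labs Y)")
    case True
    then have "fe e \<in> set (labs (relab fe Y))" by auto
    then show ?thesis using F(6)[OF True] G(6) by simp
  next
    case False
    then have "e \<in> set (ins es)" using e F(4) lder_labels(1)[OF der] by (metis UnE set_append)
    then obtain v l i out where *: "(v, l, i, out) \<in> set es" "e \<in> set i"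
      by (auto simp: in_ins)
    then show ?thesis using evF(3)[OF *] evG[OF *(1)] by simp
  qed
qed

text \<open>A decoration travels along an isomorphism. This brings the traced edges of a derivation
  to the names of the flow that gets reduced.\<close>

lemma realizes_transfer:
  assumes der: "lder bar ss X es Y" and F: "realizes F X es Y"
    and fv: "bij_betw fv (fV F) (fV G)" and fe: "bij_betw fe (fE F) (fE G)"
    and lab: "\<forall>v \<in> fV F. flab G (fv v) = flab F v"
    and edges: "\<forall>e \<in> fE F. fup G (fe e) = map_option fv (fup F e)
                  \<and> flo G (fe e) = map_option fv (flo F e)"
  shows "realizes G (relab fe X) (map (relab_event fv fe) es) (relab fe Y)"
proof -
  note evF = realizes_event[OF F]
  note F = realizesD[OF F]
  have vs: "map fst (map (relab_event fv fe) es) = map fv (map fst es)" by simp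
  have ls: "labs (relab fe X) @ outs (map (relab_event fv fe) es) = map fe (labs X @ outs es)"
    by simp
  have E: "set (labs X) \<union> set (outs es) = fE F" "set (labs Y) \<union> set (ins es) = fE F"
    using F(4) lder_labels(1)[OF der] by auto
  have ev: "fv v \<in> fV G \<and> v \<in> fV F \<and> set i \<subseteq> fE F \<and> set out \<subseteq> fE F"
    if "(v, l, i, out) \<in> set es" for v l i out
  proof -
    have "v \<in> fV F" using that F(2) by (metis fst_conv image_eqI set_map)
    moreover have "set i \<subseteq> fE F" "set out \<subseteq> fE F"
      using that E in_ins in_outs by (metis UnCI subsetI)+
    ultimately show ?thesis using fv by (auto simp: bij_betw_def)
  qed
  show ?thesis
    unfolding realizes_def vs ls
  proof (intro conjI)
    show "distinct (map fv (map fst es))"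
      using F(1,2) fv by (metis bij_betw_def distinct_map)
    show "fV G = set (map fv (map fst es))"
      using F(1,2) fv by (metis bij_betw_def set_map)
    show "distinct (map fe (labs X @ outs es))"
      using F(3,4) fe by (metis bij_betw_def distinct_map)
    show "fE G = set (map fe (labs X @ outs es))"
      using F(3,4) fe by (metis bij_betw_def set_map)
    show "\<forall>(v, l, i, out) \<in> set (map (relab_event fv fe) es). flab G v = l \<and>
       (\<forall>e \<in> set i. flo G e = Some v) \<and> (\<forall>e \<in> set out. fup G e = Some v)"
    proof (clarsimp, intro conjI ballI)
      fix v l i out assume *: "(v, l, i, out) \<in> set es"
      show "flab G (fv v) = l" using evF(2)[OF *] ev[OF *] lab by simp
      show "flo G (fe e) = Some (fv v)" if "e \<in> set i" for e
        using evF(3)[OF * that] ev[OF *] that edges by auto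
      show "fup G (fe e) = Some (fv v)" if "e \<in> set out" for e
        using evF(4)[OF * that] ev[OF *] that edges by auto
    qed
    have "fup G (fe e) = None" if "e \<in> set (labs X)" for e
      using that F(5) E(1) edges by (metis UnI1 option.map_disc_iff)
    then show "\<forall>e \<in> set (labs (relab fe X)). fup G e = None" by auto
    have "flo G (fe e) = None" if "e \<in> set (labs Y)" for e
      using that F(6) E(2) edges by (metis UnI1 option.map_disc_iff)
    then show "\<forall>e \<in> set (labs (relab fe Y)). flo G e = None" by auto
  qed
qed

section \<open>Uniqueness of decorations up to renaming\<close>

text \<open>Contexts with a common image have the same shape, hence the hole at the same place; the
  plain context of a step thus fixes how a decorated formula splits into context and redex.\<close>

lemma fill_eq_fill:
  "fill c P = fill c' P' \<Longrightarrow> map_ctx f c = map_ctx f c' \<Longrightarrow> c = c' \<and> P = P'"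
proof (induction c arbitrary: c')
  case Hole
  then show ?case by (cases c') auto
next
  case (OrL c b)
  then show ?case by (cases c') auto
next
  case (OrR a c)
  then show ?case by (cases c') auto
next
  case (AndL c b)
  then show ?case by (cases c') auto
next
  case (AndR a c)
  then show ?case by (cases c') auto
qed

text \<open>The common image forces both instances to use the same rule, and the premiss of a
  structural rule contains all its schematic variables.\<close>

lemma concl_eq_if_prem_eq:
  "\<not> atomic r \<Longrightarrow> prem b r = prem b r' \<Longrightarrow> map_inst f r = map_inst f r' \<Longrightarrow> concl b r = concl b r'"
  by (cases r; cases r') simp_all

text \<open>With distinct labels the leafwise assignment of new labels is a function; for a compound
  formula the functions of the two halves live on disjoint sets and can be merged.\<close>

lemma ex_relab:
  assumes "map_fm fst Q = map_fm fst Q'" "distinct (labs Q)"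
  shows "\<exists>g. Q' = relab g Q"
  using assms
proof (induction Q arbitrary: Q')
  case (At a)
  then obtain a' where "Q' = At a'" "fst a = fst a'" by (cases Q') auto
  then show ?case by (intro exI[of _ "\<lambda>_. snd a'"]) (auto simp: prod_eq_iff)
next
  case (Or Q1 Q2)
  then obtain Q1' Q2' where Q': "Q' = Or Q1' Q2'" by (cases Q') auto
  obtain g1 where g1: "Q1' = relab g1 Q1" using Or Q' by auto
  obtain g2 where g2: "Q2' = relab g2 Q2" using Or Q' by auto
  have "relab g1 Q1 = relab (\<lambda>e. if e \<in> set (labs Q1) then g1 e else g2 e) Q1"
    by (rule relab_cong) auto
  moreover have "relab g2 Q2 = relab (\<lambda>e. if e \<in> set (labs Q1) then g1 e else g2 e) Q2"
    by (rule relab_cong) (use Or.prems(2) in auto)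
  ultimately show ?case using Q' g1 g2 by auto
next
  case (And Q1 Q2)
  then obtain Q1' Q2' where Q': "Q' = And Q1' Q2'" by (cases Q') auto
  obtain g1 where g1: "Q1' = relab g1 Q1" using And Q' by auto
  obtain g2 where g2: "Q2' = relab g2 Q2" using And Q' by auto
  have "relab g1 Q1 = relab (\<lambda>e. if e \<in> set (labs Q1) then g1 e else g2 e) Q1"
    by (rule relab_cong) auto
  moreover have "relab g2 Q2 = relab (\<lambda>e. if e \<in> set (labs Q1) then g1 e else g2 e) Q2"
    by (rule relab_cong) (use And.prems(2) in auto)
  ultimately show ?case using Q' g1 g2 by auto
next
  case FF
  then show ?case by (cases Q') auto
next
  case TT
  then show ?case by (cases Q') auto
qed

text \<open>A structural step dictates all names below it. An atomic step chooses the names of its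
  lower edges freely, so the renaming has to be extended there. Vertex names are equally free and
  are left out of the comparison by \<open>map snd\<close>.\<close>

lemma lstep_unique:
  assumes "lstep bar s X es Z" "lstep bar s (relab g X) es' Z'" "distinct (labs X @ outs es)"
  shows "\<exists>g'. (\<forall>e \<in> set (labs X). g' e = g e) \<and> Z' = relab g' Z \<and>
    map snd es' = map (\<lambda>(l, i, out). (l, map g' i, map g' out)) (map snd es)"
  using assms
proof (cases rule: lstep.cases)
  case (lstep_struct r c)
  note A = this
  from assms(2) show ?thesis
  proof (cases rule: lstep.cases)
    case (lstep_struct r' c')
    have eq: "fill c' (prem id r') = fill (map_ctx (apsnd g) c) (prem id (map_inst (apsnd g) r))"
      using lstep_struct A by (simp add: prem_map_inst[where b' = id])
    have "map_ctx fst c' = map_ctx fst (map_ctx (apsnd g) c)"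
      using A lstep_struct by simp
    from fill_eq_fill[OF eq this] have c': "c' = map_ctx (apsnd g) c"
      and p: "prem id r' = prem id (map_inst (apsnd g) r)" by auto
    have "concl id r' = concl id (map_inst (apsnd g) r)"
      by (rule concl_eq_if_prem_eq[OF _ p, of fst]) (use A lstep_struct in auto)
    then show ?thesis using A lstep_struct c'
      by (intro exI[of _ g]) (simp add: concl_map_inst[where b' = id])
  next
    case (lstep_atomic r' P Q c' v)
    then show ?thesis using A by auto
  qed
next
  case (lstep_atomic r P Q c v)
  note A = this
  from assms(2) show ?thesis
  proof (cases rule: lstep.cases)
    case (lstep_struct r' c')
    then show ?thesis using A by auto
  next
    case (lstep_atomic r' P' Q' c' v')
    have eq: "fill c' P' = fill (map_ctx (apsnd g) c) (relab g P)"
      using lstep_atomic A by simp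
    have "map_ctx fst c' = map_ctx fst (map_ctx (apsnd g) c)"
      using A lstep_atomic by simp
    from fill_eq_fill[OF eq this] have c': "c' = map_ctx (apsnd g) c" and P': "P' = relab g P"
      by auto
    have dis: "distinct (labs Q)" "set (labs X) \<inter> set (labs Q) = {}"
      using assms(3) A by auto
    obtain h where h: "Q' = relab h Q"
      using ex_relab[of Q Q'] dis A lstep_atomic by auto
    \<comment> \<open>The labels of \<open>Q\<close> are new, so overriding \<open>g\<close> on them
      does not disturb the premiss.\<close>
    define g' where "g' e = (if e \<in> set (labs Q) then h e else g e)" for e
    have g'X: "\<forall>e \<in> set (labs X). g' e = g e" using dis by (auto simp: g'_def)
    have Q': "Q' = relab g' Q" unfolding h by (rule relab_cong) (auto simp: g'_def)
    have sub: "set (ctx_labs c) \<subseteq> set (labs X)" "set (labs P) \<subseteq> set (labs X)"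
      using A(2) set_atoms_fill[of c P] by auto
    have c'': "c' = map_ctx (apsnd g') c"
      unfolding c' by (rule ctx_relab_cong) (metis g'X sub(1) subsetD)
    have P'': "P' = relab g' P"
      unfolding P' by (rule relab_cong) (metis g'X sub(2) subsetD)
    show ?thesis
      using A lstep_atomic g'X by (intro exI[of _ g']) (simp add: c'' P'' Q')
  qed
qed

lemma event_relab_cong:
  assumes "\<And>e. e \<in> set (ins es) \<Longrightarrow> f e = g e" "\<And>e. e \<in> set (outs es) \<Longrightarrow> f e = g e"
  shows "map (\<lambda>(l, i, out). (l, map f i, map f out)) (map snd es) =
    map (\<lambda>(l, i, out). (l, map g i, map g out)) (map snd es)"
proof -
  have "f e = g e" if "(v, l, i, out) \<in> set es" "e \<in> set i \<union> set out" for v l i out e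
    using that assms in_ins in_outs by (metis UnE)
  then show ?thesis by auto
qed

lemma lder_unique:
  assumes "lder bar ss X es Y" "lder bar ss (relab g X) es' Y'" "distinct (labs X @ outs es)"
  shows "\<exists>g'. (\<forall>e \<in> set (labs X). g' e = g e) \<and> Y' = relab g' Y \<and>
    map snd es' = map (\<lambda>(l, i, out). (l, map g' i, map g' out)) (map snd es)"
  using assms
proof (induction arbitrary: g es' Y' rule: lder.induct)
  case (lder_Nil X)
  then show ?case by (auto elim: lder.cases)
next
  case (lder_Cons s X es Z ss es2 Y)
  obtain es1' Z' es2' where st: "lstep bar s (relab g X) es1' Z'" "lder bar ss Z' es2' Y'"
    and es': "es' = es1' @ es2'"
    using lder_Cons.prems(1) by (auto elim: lder.cases)
  have "distinct (labs X @ outs es)" using lder_Cons.prems(2) by auto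
  from lstep_unique[OF lder_Cons.hyps(1) st(1) this] obtain g1 where
    g1: "\<forall>e \<in> set (labs X). g1 e = g e" "Z' = relab g1 Z"
    "map snd es1' = map (\<lambda>(l, i, out). (l, map g1 i, map g1 out)) (map snd es)" by blast
  have cons: "lder bar [s] X es Z" using lder.lder_Cons[OF lder_Cons.hyps(1) lder_Nil] by simp
  have labZ: "set (labs X) \<union> set (outs es) = set (labs Z) \<union> set (ins es)"
    "distinct (labs Z @ ins es)"
    using lder_labels[OF cons] lder_Cons.prems(2) by auto
  have "set (labs Z) \<inter> set (outs es2) = {}"
    using labZ(1) lder_Cons.prems(2) by (simp only: distinct_append outs_simps set_append) blast
  then have "distinct (labs Z @ outs es2)"
    using labZ lder_Cons.prems(2) by simp
  from lder_Cons.IH[OF st(2)[unfolded g1(2)] this] obtain g2 where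
    g2: "\<forall>e \<in> set (labs Z). g2 e = g1 e" "Y' = relab g2 Y"
    "map snd es2' = map (\<lambda>(l, i, out). (l, map g2 i, map g2 out)) (map snd es2)" by blast
  \<comment> \<open>On edges that survive in \<open>Z\<close> both renamings agree. Edges consumed
    by the first step are out of reach for \<open>g2\<close>, so \<open>g1\<close> must decide
    them.\<close>
  define E where "E = set (labs X) \<union> set (outs es)"
  define g3 where "g3 e = (if e \<in> E then g1 e else g2 e)" for e
  have g31: "g3 e = g1 e" if "e \<in> set (labs X) \<union> set (outs es)" for e
    using that by (auto simp: g3_def E_def)
  have g32: "g3 e = g2 e" if "e \<in> set (labs Z) \<union> set (outs es2)" for e
  proof (cases "e \<in> set (labs Z)")
    case True
    then have "g2 e = g1 e" using g2(1) by blast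
    then show ?thesis by (simp add: g3_def)
  next
    case False
    then have "e \<notin> E"
      using that lder_Cons.prems(2) unfolding E_def
      by (simp only: distinct_append outs_simps set_append) blast
    then show ?thesis by (simp add: g3_def)
  qed
  have "map snd es1' = map (\<lambda>(l, i, out). (l, map g3 i, map g3 out)) (map snd es)"
    unfolding g1(3) by (rule event_relab_cong) (metis g31 labZ(1) UnI1 UnI2)+
  moreover have "map snd es2' = map (\<lambda>(l, i, out). (l, map g3 i, map g3 out)) (map snd es2)"
    unfolding g2(3)
    by (rule event_relab_cong) (metis g32 lder_labels(1)[OF lder_Cons.hyps(2)] UnI1 UnI2)+
  moreover have "Y' = relab g3 Y"
    unfolding g2(2) by (rule relab_cong) (metis g32 lder_labels(1)[OF lder_Cons.hyps(2)] UnI1)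
  ultimately show ?case using g31 g1(1) es' by (intro exI[of _ g3]) simp
qed


text \<open>Vertices occur once each, so pairing the two event lists entry by entry defines a
  renaming of vertices.\<close>

lemma relab_event_eq:
  assumes "map snd es' = map (\<lambda>(l, i, out). (l, map g i, map g out)) (map snd es)"
    and "distinct (map fst es)"
  shows "\<exists>h. es' = map (relab_event h g) es"
  using assms
proof (induction es arbitrary: es')
  case (Cons ev es)
  obtain v l i out where ev: "ev = (v, l, i, out)" by (cases ev)
  obtain v' es1 where es': "es' = (v', l, map g i, map g out) # es1"
    and "map snd es1 = map (\<lambda>(l, i, out). (l, map g i, map g out)) (map snd es)"
    using Cons.prems(1) ev by (cases es') auto
  with Cons obtain h where h: "es1 = map (relab_event h g) es" by auto
  have "map (relab_event h g) es = map (relab_event (h(v := v')) g) es"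
    using Cons.prems(2) ev by (force simp: relab_event_def)
  then have "es' = map (relab_event (h(v := v')) g) (ev # es)"
    using es' h ev by (simp del: map_eq_conv)
  then show ?case by blast
qed simp

text \<open>Any decoration at all identifies the flow of a derivation up to isomorphism, so a
  derivation built with the names of a reduct need not be compared with its traced edges
  directly.\<close>

theorem realizes_unique:
  assumes der: "lder bar ss X es Y" and F: "realizes F X es Y"
    and der': "lder bar ss X' es' Y'" and G: "realizes G X' es' Y'"
    and "map_fm fst X = map_fm fst X'"
  shows "flow_iso F G"
proof -
  obtain g0 where g0: "X' = relab g0 X"
    using ex_relab[OF assms(5)] realizesD(3)[OF F] by auto
  obtain g where g: "\<forall>e \<in> set (labs X). g e = g0 e" "Y' = relab g Y"
    and es': "map snd es' = map (\<lambda>(l, i, out). (l, map g i, map g out)) (map snd es)"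
    using lder_unique[OF der der'[unfolded g0] realizesD(3)[OF F]] by blast
  have X': "X' = relab g X" unfolding g0 by (rule relab_cong) (use g(1) in metis)
  obtain h where h: "es' = map (relab_event h g) es"
    using relab_event_eq[OF es' realizesD(1)[OF F]] by blast
  show ?thesis
    using realizes_iso[OF der F] G unfolding h X' g(2) by blast
qed

section \<open>The flow of a derivation\<close>

fun label :: "(nat list \<Rightarrow> 'e) \<Rightarrow> 'a fm \<Rightarrow> ('a \<times> 'e) fm" where
  "label f (At a) = At (a, f [])"
| "label f (Or x y) = Or (label (\<lambda>p. f (0 # p)) x) (label (\<lambda>p. f (1 # p)) y)"
| "label f (And x y) = And (label (\<lambda>p. f (0 # p)) x) (label (\<lambda>p. f (1 # p)) y)"
| "label f FF = FF"
| "label f TT = TT"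

fun label_ctx :: "(nat list \<Rightarrow> 'e) \<Rightarrow> 'a ctx \<Rightarrow> ('a \<times> 'e) ctx" where
  "label_ctx f Hole = Hole"
| "label_ctx f (OrL c b) = OrL (label_ctx (\<lambda>p. f (0 # p)) c) (label (\<lambda>p. f (1 # p)) b)"
| "label_ctx f (OrR a c) = OrR (label (\<lambda>p. f (0 # p)) a) (label_ctx (\<lambda>p. f (1 # p)) c)"
| "label_ctx f (AndL c b) = AndL (label_ctx (\<lambda>p. f (0 # p)) c) (label (\<lambda>p. f (1 # p)) b)"
| "label_ctx f (AndR a c) = AndR (label (\<lambda>p. f (0 # p)) a) (label_ctx (\<lambda>p. f (1 # p)) c)"

fun label_inst :: "(nat list \<Rightarrow> 'e) \<Rightarrow> 'a inst \<Rightarrow> ('a \<times> 'e) inst" where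
  "label_inst f (RSw x y z) =
     RSw (label (\<lambda>p. f (0 # p)) x) (label (\<lambda>p. f (1 # 0 # p)) y) (label (\<lambda>p. f (1 # 1 # p)) z)"
| "label_inst f (RMed x y z w) =
     RMed (label (\<lambda>p. f (0 # 0 # p)) x) (label (\<lambda>p. f (0 # 1 # p)) y)
       (label (\<lambda>p. f (1 # 0 # p)) z) (label (\<lambda>p. f (1 # 1 # p)) w)"
| "label_inst f (EOrComm x y) = EOrComm (label (\<lambda>p. f (0 # p)) x) (label (\<lambda>p. f (1 # p)) y)"
| "label_inst f (EAndComm x y) = EAndComm (label (\<lambda>p. f (0 # p)) x) (label (\<lambda>p. f (1 # p)) y)"
| "label_inst f (EOrAs1 x y z) =
     EOrAs1 (label (\<lambda>p. f (0 # 0 # p)) x) (label (\<lambda>p. f (0 # 1 # p)) y) (label (\<lambda>p. f (1 # p)) z)"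
| "label_inst f (EOrAs2 x y z) =
     EOrAs2 (label (\<lambda>p. f (0 # p)) x) (label (\<lambda>p. f (1 # 0 # p)) y) (label (\<lambda>p. f (1 # 1 # p)) z)"
| "label_inst f (EAndAs1 x y z) =
     EAndAs1 (label (\<lambda>p. f (0 # 0 # p)) x) (label (\<lambda>p. f (0 # 1 # p)) y) (label (\<lambda>p. f (1 # p)) z)"
| "label_inst f (EAndAs2 x y z) =
     EAndAs2 (label (\<lambda>p. f (0 # p)) x) (label (\<lambda>p. f (1 # 0 # p)) y) (label (\<lambda>p. f (1 # 1 # p)) z)"
| "label_inst f (EOrU1 x) = EOrU1 (label (\<lambda>p. f (0 # p)) x)"
| "label_inst f (EOrU2 x) = EOrU2 (label f x)"
| "label_inst f (EAndU1 x) = EAndU1 (label (\<lambda>p. f (0 # p)) x)"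
| "label_inst f (EAndU2 x) = EAndU2 (label f x)"
| "label_inst f ETT1 = ETT1"
| "label_inst f ETT2 = ETT2"
| "label_inst f EFF1 = EFF1"
| "label_inst f EFF2 = EFF2"
| "label_inst f _ = ETT1" \<comment> \<open>junk value for the atomic rules\<close>

text \<open>The part of \<open>tr\<close> that acts inside the redex, isolated so that the context
  is dealt with separately and only once.\<close>

definition tr_redex :: "'a inst \<Rightarrow> nat list \<Rightarrow> nat list option" where
  "tr_redex r p = (case find (\<lambda>(a, b). take (length a) p = a) (vmap r) of
     Some (a, b) \<Rightarrow> Some (b @ drop (length a) p) | None \<Rightarrow> None)"

lemma map_fst_label [simp]: "map_fm fst (label f x) = x"
  by (induction x arbitrary: f) auto

lemma map_ctx_fst_label [simp]: "map_ctx fst (label_ctx f c) = c"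
  by (induction c arbitrary: f) auto

lemma map_inst_fst_label: "\<not> atomic r \<Longrightarrow> map_inst fst (label_inst f r) = r"
  by (cases r) auto

lemma atomic_label_inst [simp]: "\<not> atomic (label_inst f r)"
  by (cases r) auto

lemma label_fill: "label f (fill c x) = fill (label_ctx f c) (label (\<lambda>p. f (hpos c @ p)) x)"
  by (induction c arbitrary: f) auto

lemma label_cong: "(\<And>p. p \<in> atpos x \<Longrightarrow> f p = g p) \<Longrightarrow> label f x = label g x"
proof (induction x arbitrary: f g)
  case (Or x y)
  show ?case unfolding label.simps
    by (intro arg_cong2[of _ _ _ _ Or] Or.IH; rule Or.prems) auto
next
  case (And x y)
  show ?case unfolding label.simps
    by (intro arg_cong2[of _ _ _ _ And] And.IH; rule And.prems) auto
qed auto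

text \<open>A context does not see the names inside its hole; the filler \<open>x\<close> only
  supplies an ambient formula in which positions off the hole can be spoken of.\<close>

lemma label_ctx_cong:
  "(\<And>p. p \<in> atpos (fill c x) \<Longrightarrow> take (length (hpos c)) p \<noteq> hpos c \<Longrightarrow> f p = g p) \<Longrightarrow>
    label_ctx f c = label_ctx g c"
proof (induction c arbitrary: f g)
  case (OrL c b)
  show ?case by (auto intro!: OrL.IH label_cong OrL.prems)
next
  case (OrR c b)
  show ?case by (auto intro!: OrR.IH label_cong OrR.prems)
next
  case (AndL c b)
  show ?case by (auto intro!: AndL.IH label_cong AndL.prems)
next
  case (AndR c b)
  show ?case by (auto intro!: AndR.IH label_cong AndR.prems)
qed auto

lemma prem_label_inst: "\<not> atomic r \<Longrightarrow> prem id (label_inst f r) = label f (prem bar r)"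
  by (cases r) auto

text \<open>A structural instance is decorated by its premiss positions. The hypothesis says that
  names follow the tracing, and \<open>vmap\<close> sends each schematic variable exactly to its
  place in the conclusion.\<close>

lemma concl_label_inst:
  assumes "\<not> atomic r"
    and "\<And>p q. p \<in> atpos (prem bar r) \<Longrightarrow> tr_redex r p = Some q \<Longrightarrow> g q = f p"
  shows "concl id (label_inst f r) = label g (concl bar r)"
proof -
  have "\<forall>p \<in> atpos (prem bar r). \<forall>q. tr_redex r p = Some q \<longrightarrow> g q = f p"
    using assms(2) by blast
  with assms(1) show ?thesis
    by (cases r) (auto simp: tr_redex_def ball_Un intro!: label_cong)
qed

lemma tr_redex_inj:
  assumes "p \<in> atpos (prem bar r)" "p' \<in> atpos (prem bar r)"
    "tr_redex r p = Some q" "tr_redex r p' = Some q"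
  shows "p = p'"
  using assms by (cases r) (auto simp: tr_redex_def)

lemma tr_redex_struct: "\<not> atomic r \<Longrightarrow> p \<in> atpos (prem bar r) \<Longrightarrow> tr_redex r p \<noteq> None"
  by (cases r) (auto simp: tr_redex_def)

lemma tr_redex_atomic: "atomic r \<Longrightarrow> tr_redex r p = None"
  by (cases r) (auto simp: tr_redex_def)

lemma set_labs_label: "set (labs (label f x)) = f ` atpos x"
proof (induction x arbitrary: f)
  case (Or x y)
  then show ?case by (simp add: image_Un image_image del: set_atoms)
next
  case (And x y)
  then show ?case by (simp add: image_Un image_image del: set_atoms)
qed auto

lemma distinct_labs_label: "inj_on f (atpos x) \<Longrightarrow> distinct (labs (label f x))"
proof (induction x arbitrary: f)
  case (Or x y)
  note inj = inj_onD[OF Or.prems]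
  have "inj_on (\<lambda>p. f (0 # p)) (atpos x)" "inj_on (\<lambda>p. f (1 # p)) (atpos y)"
    by (auto intro!: inj_onI dest: inj)
  moreover have "set (labs (label (\<lambda>p. f (0 # p)) x)) \<inter> set (labs (label (\<lambda>p. f (1 # p)) y)) = {}"
    unfolding set_labs_label by (auto dest: inj)
  ultimately show ?case using Or.IH by (simp del: set_atoms)
next
  case (And x y)
  note inj = inj_onD[OF And.prems]
  have "inj_on (\<lambda>p. f (0 # p)) (atpos x)" "inj_on (\<lambda>p. f (1 # p)) (atpos y)"
    by (auto intro!: inj_onI dest: inj)
  moreover have "set (labs (label (\<lambda>p. f (0 # p)) x)) \<inter> set (labs (label (\<lambda>p. f (1 # p)) y)) = {}"
    unfolding set_labs_label by (auto dest: inj)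
  ultimately show ?case using And.IH by (simp del: set_atoms)
qed auto

lemma atpos_fill_hole: "hpos c @ p \<in> atpos (fill c x) \<longleftrightarrow> p \<in> atpos x"
  by (induction c) auto

lemma tr_hole: "tr (c, r) (hpos c @ p) = map_option ((@) (hpos c)) (tr_redex r p)"
  by (auto simp: tr_def tr_redex_def Let_def split: option.splits)

lemma tr_off: "take (length (hpos c)) p \<noteq> hpos c \<Longrightarrow> tr (c, r) p = Some p"
  by (auto simp: tr_def Let_def)

lemma hole_cases:
  obtains p' where "p = hpos c @ p'" | "take (length (hpos c)) p \<noteq> hpos c"
  by (metis append_take_drop_id)

lemma tr_inj:
  assumes "p \<in> atpos (fill c (prem bar r))" "p' \<in> atpos (fill c (prem bar r))"
    "tr (c, r) p = Some q" "tr (c, r) p' = Some q"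
  shows "p = p'"
proof (rule hole_cases[of p c]; rule hole_cases[of p' c])
  fix u v assume "p = hpos c @ u" "p' = hpos c @ v"
  then show ?thesis using assms tr_redex_inj[of u bar r v] by (auto simp: tr_hole atpos_fill_hole)
qed (use assms in \<open>auto simp: tr_hole tr_off\<close>)

text \<open>The bridge from tracing positions to decorated steps. The hypothesis leaves
  \<open>g\<close> unconstrained on occurrences created by the step, whose edges start
  there.\<close>

lemma lstep_label:
  assumes "\<And>p q. p \<in> atpos (fill c (prem bar r)) \<Longrightarrow> tr (c, r) p = Some q \<Longrightarrow> g q = f p"
  shows "lstep bar (c, r) (label f (fill c (prem bar r)))
    (if atomic r then [(v, lblof r, labs (label (\<lambda>p. f (hpos c @ p)) (prem bar r)),
        labs (label (\<lambda>p. g (hpos c @ p)) (concl bar r)))] else [])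
    (label g (fill c (concl bar r)))"
proof -
  have ctx: "label_ctx f c = label_ctx g c"
    by (rule label_ctx_cong[of c "prem bar r"]) (metis assms tr_off)
  show ?thesis
  proof (cases "atomic r")
    case True
    then show ?thesis
      using lstep_atomic[of r "label (\<lambda>p. f (hpos c @ p)) (prem bar r)" bar
          "label (\<lambda>p. g (hpos c @ p)) (concl bar r)" "label_ctx f c" v]
      by (simp add: label_fill ctx)
  next
    case False
    let ?r = "label_inst (\<lambda>p. f (hpos c @ p)) r"
    have "concl id ?r = label (\<lambda>p. g (hpos c @ p)) (concl bar r)"
      by (rule concl_label_inst[OF False]) (use assms in \<open>auto simp: atpos_fill_hole tr_hole\<close>)
    then show ?thesis
      using lstep_struct[of ?r bar "label_ctx f c"] False
      by (simp add: label_fill ctx prem_label_inst[of r _ bar] map_inst_fst_label)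
  qed
qed

lemma fmls_0: "fmls bar x ss ! 0 = x"
  by (cases ss) auto

lemma fmls_step:
  "derivation bar x ss \<Longrightarrow> k < length ss \<Longrightarrow>
    fmls bar x ss ! k = fill (fst (ss ! k)) (prem bar (snd (ss ! k))) \<and>
    fmls bar x ss ! Suc k = fill (fst (ss ! k)) (concl bar (snd (ss ! k)))"
proof (induction ss arbitrary: x k)
  case (Cons s ss)
  obtain c r where s: "s = (c, r)" by (cases s)
  show ?case
  proof (cases k)
    case 0
    then show ?thesis using Cons.prems s by (auto simp: fmls_0)
  next
    case (Suc j)
    then show ?thesis using Cons s by auto
  qed
qed simp

lemma dflow_simps:
  "fV (dflow bar x ss) = {k. k < length ss \<and> atomic (snd (ss ! k))}"
  "fE (dflow bar x ss) = {src (fmls bar x ss) ss k p | k p. k \<le> length ss \<and> p \<in> atpos (fmls bar x ss ! k)}"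
  "flab (dflow bar x ss) = (\<lambda>k. lblof (snd (ss ! k)))"
  "fup (dflow bar x ss) = (\<lambda>e. if fst e = 0 then None else Some (fst e - 1))"
  "flo (dflow bar x ss) = (let cons = (\<lambda>e k. \<exists>p. k < length ss \<and> p \<in> atpos (fmls bar x ss ! k) \<and>
     src (fmls bar x ss) ss k p = e \<and> tr (ss ! k) p = None) in
     (\<lambda>e. if \<exists>k. cons e k then Some (THE k. cons e k) else None))"
  by (simp_all add: dflow_def Let_def)

text \<open>Needed for the definite description that defines the lower end of an edge in
  \<open>dflow\<close>.\<close>

lemma distinct_ins_unique:
  assumes "distinct (ins es)" "(v, l, i, out) \<in> set es" "(v', l', i', out') \<in> set es"
    "e \<in> set i" "e \<in> set i'"
  shows "(v, l, i, out) = (v', l', i', out')"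
  using assms
proof (induction es)
  case (Cons ev es)
  obtain w k j ou where ev: "ev = (w, k, j, ou)" by (cases ev)
  have "e \<notin> set j \<or> e \<notin> set (ins es)" "distinct (ins es)" using Cons.prems(1) ev by auto
  moreover have "e \<in> set (ins es)" if "(u, m, a, b) \<in> set es" "e \<in> set a" for u m a b
    using that in_ins by metis
  ultimately show ?case using Cons.prems(2-) Cons.IH ev by (auto 5 0)
qed simp

text \<open>The occurrence \<open>p\<close> of the \<open>k\<close>-th formula is decorated by
  \<open>src\<close> at \<open>k\<close>, and the event of an atomic step has the index of the step
  as its vertex.\<close>

theorem dflow_realized:
  fixes x :: "'a fm"
  assumes der: "derivation bar x ss"
  shows "\<exists>X es Y. lder bar ss X es Y \<and> realizes (dflow bar x ss) X es Y \<and>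
    map_fm fst X = x \<and> map_fm fst Y = dconcl bar x ss"
proof -
  define fs where "fs = fmls bar x ss"
  define n where "n = length ss"
  define C where "C k = fst (ss ! k)" for k
  define r where "r k = snd (ss ! k)" for k
  have ss: "ss ! k = (C k, r k)" for k by (simp add: C_def r_def)
  have fs0: "fs ! 0 = x" by (simp add: fs_def fmls_0)
  have fsk: "fs ! k = fill (C k) (prem bar (r k))" "fs ! Suc k = fill (C k) (concl bar (r k))"
    if "k < n" for k
    using fmls_step[OF der] that by (simp_all add: n_def fs_def C_def r_def)
  let ?s = "src fs ss"
  \<comment> \<open>Tracing is injective, so the description in \<open>src\<close> picks out the one
    ancestor of \<open>p\<close>.\<close>
  have src_tr: "?s (Suc k) p = ?s k q"
    if "k < n" "q \<in> atpos (fs ! k)" "tr (ss ! k) q = Some p" for k p q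
  proof -
    have "(THE q. q \<in> atpos (fs ! k) \<and> tr (ss ! k) q = Some p) = q"
      using that tr_inj[of _ "C k" bar "r k"] by (intro the_equality) (auto simp: ss fsk)
    then show ?thesis using that by auto
  qed
  \<comment> \<open>No position in an atomic redex is traced onward, so an occurrence created by
    step \<open>k\<close> starts an edge. Its first component is \<open>Suc k\<close>: this is why
    \<open>fup\<close> subtracts one and why 0 is left to the premiss.\<close>
  have src_new: "?s (Suc k) (hpos (C k) @ p) = (Suc k, hpos (C k) @ p)" if "atomic (r k)" for k p
  proof -
    have "tr (ss ! k) q \<noteq> Some (hpos (C k) @ p)" for q
      by (rule hole_cases[of q "C k"]) (auto simp: ss tr_hole tr_off tr_redex_atomic[OF that])
    then show ?thesis by simp
  qed
  define L where "L k = label (?s k) (fs ! k)" for k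
  define ev where "ev k = (k, lblof (r k), labs (label (\<lambda>p. ?s k (hpos (C k) @ p)) (prem bar (r k))),
     labs (label (\<lambda>p. ?s (Suc k) (hpos (C k) @ p)) (concl bar (r k))))" for k
  define evs where "evs m = map ev (filter (\<lambda>k. atomic (r k)) [0..<m])" for m
  have evs_Suc: "evs (Suc m) = evs m @ (if atomic (r m) then [ev m] else [])" for m
    by (simp add: evs_def)
  have lder: "lder bar (take m ss) (L 0) (evs m) (L m)" if "m \<le> n" for m
    using that
  proof (induction m)
    case 0
    then show ?case by (simp add: evs_def lder_Nil)
  next
    case (Suc m)
    have "lstep bar (C m, r m) (L m) (if atomic (r m) then [ev m] else []) (L (Suc m))"
      using lstep_label[of "C m" bar "r m" "?s (Suc m)" "?s m" m] src_tr[of m] Suc.prems fsk[of m]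
      unfolding L_def ev_def by (simp add: ss)
    then show ?case
      using lder_snoc[OF Suc.IH] Suc.prems
      by (simp add: evs_Suc take_Suc_conv_app_nth n_def ss)
  qed
  have set_outs: "set (outs (evs m)) = {(Suc k, hpos (C k) @ p) | k p.
      k < m \<and> atomic (r k) \<and> p \<in> atpos (concl bar (r k))}" for m
  proof (induction m)
    case (Suc m)
    then show ?case
      by (auto simp: evs_Suc ev_def set_labs_label src_new less_Suc_eq
          simp del: set_atoms src.simps set_map)
  qed (simp add: evs_def)
  have labs0: "set (labs (L 0)) = {(0, p) | p. p \<in> atpos x}"
    by (auto simp: L_def set_labs_label fs0 simp del: set_map)
  \<comment> \<open>The first component of an edge tells which step creates it, so different steps
    cannot contribute the same edge.\<close>
  have dist_outs: "distinct (outs (evs m))" for m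
  proof (induction m)
    case (Suc m)
    have "distinct (labs (label (\<lambda>p. ?s (Suc m) (hpos (C m) @ p)) (concl bar (r m))))"
      if "atomic (r m)"
      by (rule distinct_labs_label) (simp add: inj_on_def src_new[OF that] del: src.simps)
    then show ?case using Suc set_outs[of m]
      by (auto simp: evs_Suc ev_def set_labs_label src_new
          simp del: set_atoms src.simps set_map)
  qed (simp add: evs_def)
  have dist: "distinct (labs (L 0) @ outs (evs m))" for m
    using dist_outs labs0 set_outs[of m]
    by (auto simp: L_def inj_on_def intro!: distinct_labs_label simp del: set_map)
  let ?F = "dflow bar x ss"
  have fst_ev: "map fst (evs m) = filter (\<lambda>k. atomic (r k)) [0..<m]" for m
    by (simp add: evs_def ev_def comp_def)
  have lder_n: "lder bar ss (L 0) (evs n) (L n)" using lder[of n] by (simp add: n_def)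
  have ev_in: "ev k \<in> set (evs n) \<longleftrightarrow> k < n \<and> atomic (r k)" for k
    by (auto simp: evs_def ev_def)
  \<comment> \<open>Outside the redex, and inside a structural redex, every occurrence is traced
    onward. An edge can thus end only in the redex of an atomic step.\<close>
  have consumed: "k < n \<and> p \<in> atpos (fs ! k) \<and> ?s k p = e \<and> tr (ss ! k) p = None \<Longrightarrow>
      k < n \<and> atomic (r k) \<and> e \<in> set (labs (label (\<lambda>p. ?s k (hpos (C k) @ p)) (prem bar (r k))))"
    for k p e
    using tr_redex_struct[of "r k" _ bar] fsk[of k]
    by (rule_tac hole_cases[of p "C k"])
      (force simp: ss tr_hole tr_off atpos_fill_hole set_labs_label simp del: set_map)+
  have consumed': "\<exists>p. k < n \<and> p \<in> atpos (fs ! k) \<and> ?s k p = e \<and> tr (ss ! k) p = None"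
    if k: "k < n" "atomic (r k)"
      "e \<in> set (labs (label (\<lambda>p. ?s k (hpos (C k) @ p)) (prem bar (r k))))" for k e
  proof -
    obtain p where "p \<in> atpos (prem bar (r k))" "e = ?s k (hpos (C k) @ p)"
      using k(3) unfolding set_labs_label by auto
    then show ?thesis using k fsk(1)[of k]
      by (intro exI[of _ "hpos (C k) @ p"]) (auto simp: ss tr_hole tr_redex_atomic atpos_fill_hole)
  qed
  define cons where "cons e k \<longleftrightarrow> (\<exists>p. k < n \<and> p \<in> atpos (fs ! k) \<and> ?s k p = e \<and>
      tr (ss ! k) p = None)" for e k
  have flo: "flo ?F e = (if \<exists>k. cons e k then Some (THE k. cons e k) else None)" for e
    unfolding dflow_simps cons_def fs_def n_def Let_def ..
  have cons_iff: "cons e k \<longleftrightarrow> k < n \<and> atomic (r k) \<and>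
      e \<in> set (labs (label (\<lambda>p. ?s k (hpos (C k) @ p)) (prem bar (r k))))" for e k
    unfolding cons_def using consumed consumed' by blast
  have dist_ins: "distinct (labs (L n) @ ins (evs n))"
    using lder_labels(2)[OF lder_n] dist by blast
  have cons_ins: "e \<in> set (ins (evs n))" if "cons e k" for e k
    using that ev_in[of k] unfolding cons_iff in_ins ev_def by blast
  \<comment> \<open>Edges start once, hence by conservation they end once, and the description in
    \<open>flo\<close> is well defined.\<close>
  have cons_unique: "k = k'" if "cons e k" "cons e k'" for e k k'
    using that distinct_ins_unique[of "evs n" k _ _ _ k' _ _ _ e] dist_ins ev_in[of k] ev_in[of k']
    unfolding cons_iff ev_def distinct_append by blast
  have flo_Some: "flo ?F e = Some k" if "cons e k" for e k
  proof -
    have "(THE k. cons e k) = k" using that cons_unique by (intro the_equality) blast+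
    then show ?thesis using that unfolding flo by auto
  qed
  show ?thesis
  proof (intro exI conjI)
    show "lder bar ss (L 0) (evs n) (L n)" by fact
    show fstX: "map_fm fst (L 0) = x" by (simp add: L_def fs0)
    show "map_fm fst (L n) = dconcl bar x ss"
      using lder_derivation[OF lder_n] by (simp add: fstX)
    show "realizes ?F (L 0) (evs n) (L n)"
      unfolding realizes_def
    proof (intro conjI)
      show "distinct (map fst (evs n))" "fV ?F = set (map fst (evs n))"
        unfolding fst_ev by (auto simp: dflow_simps n_def r_def)
      show "distinct (labs (L 0) @ outs (evs n))" by fact
      show "fE ?F = set (labs (L 0) @ outs (evs n))"
      proof (intro equalityI subsetI)
        fix e assume "e \<in> fE ?F"
        then obtain k p where k: "k \<le> n" "p \<in> atpos (fs ! k)" "e = ?s k p"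
          by (auto simp: dflow_simps fs_def n_def)
        then have "e \<in> set (labs (L k))" unfolding L_def set_labs_label by blast
        then have "e \<in> set (labs (L 0)) \<union> set (outs (evs k))"
          using lder_labels(1)[OF lder[OF k(1)]] by blast
        moreover have "set (outs (evs k)) \<subseteq> set (outs (evs n))" using k(1) by (auto simp: set_outs)
        ultimately show "e \<in> set (labs (L 0) @ outs (evs n))" unfolding set_append by blast
      next
        fix e assume "e \<in> set (labs (L 0) @ outs (evs n))"
        then consider p where "e = (0, p)" "p \<in> atpos x"
          | k p where "e = (Suc k, hpos (C k) @ p)" "k < n" "atomic (r k)" "p \<in> atpos (concl bar (r k))"
          unfolding set_append labs0 set_outs by blast
        then have "\<exists>k p. e = ?s k p \<and> k \<le> n \<and> p \<in> atpos (fs ! k)"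
        proof cases
          case (1 p)
          then show ?thesis by (intro exI[of _ 0] exI[of _ p]) (simp add: fs0)
        next
          case (2 k p)
          then show ?thesis
            by (intro exI[of _ "Suc k"] exI[of _ "hpos (C k) @ p"])
              (auto simp: fsk src_new atpos_fill_hole simp del: src.simps)
        qed
        then show "e \<in> fE ?F" by (simp add: dflow_simps fs_def n_def)
      qed
      show "\<forall>e\<in>set (labs (L 0)). fup ?F e = None"
        by (auto simp only: labs0 dflow_simps) auto
      show "\<forall>e\<in>set (labs (L n)). flo ?F e = None"
        using cons_ins dist_ins unfolding flo distinct_append by (metis disjoint_iff)
      show "\<forall>(v, l, i, out)\<in>set (evs n). flab ?F v = l \<and>
          (\<forall>e\<in>set i. flo ?F e = Some v) \<and> (\<forall>e\<in>set out. fup ?F e = Some v)"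
      proof (clarify, intro conjI ballI)
        fix v l i out assume "(v, l, i, out) \<in> set (evs n)"
        then have v: "(v, l, i, out) = ev v" "v < n" "atomic (r v)"
          by (auto simp: evs_def ev_def)
        show "flab ?F v = l" using v(1) by (simp add: dflow_simps ev_def r_def)
        show "flo ?F e = Some v" if "e \<in> set i" for e
          by (rule flo_Some) (use that v in \<open>simp add: cons_iff ev_def\<close>)
        show "fup ?F e = Some v" if "e \<in> set out" for e
        proof -
          have "e \<in> (\<lambda>p. ?s (Suc v) (hpos (C v) @ p)) ` atpos (concl bar (r v))"
            using that v(1) unfolding ev_def set_labs_label[symmetric] by simp
          then show ?thesis by (auto simp: src_new[OF v(3)] dflow_simps simp del: src.simps)
        qed
      qed
    qed
  qed
qed

section \<open>Structural derivations\<close>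

text \<open>From here on only the event list and the two decorated ends matter: they determine the
  flow, so the steps themselves can be hidden.\<close>

definition derives :: "('a \<Rightarrow> 'a) \<Rightarrow> ('a \<times> 'e) fm \<Rightarrow> ('v, 'e) event list \<Rightarrow> ('a \<times> 'e) fm \<Rightarrow> bool" where
  "derives bar X es Y \<longleftrightarrow> (\<exists>ss. lder bar ss X es Y)"

fun ctx_comp :: "'x ctx \<Rightarrow> 'x ctx \<Rightarrow> 'x ctx" where
  "ctx_comp Hole d = d"
| "ctx_comp (OrL c b) d = OrL (ctx_comp c d) b"
| "ctx_comp (OrR a c) d = OrR a (ctx_comp c d)"
| "ctx_comp (AndL c b) d = AndL (ctx_comp c d) b"
| "ctx_comp (AndR a c) d = AndR a (ctx_comp c d)"

lemma fill_ctx_comp [simp]: "fill (ctx_comp c d) x = fill c (fill d x)"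
  by (induction c) auto

lemma derives_refl [simp]: "derives bar X [] X"
  unfolding derives_def by (blast intro: lder_Nil)

lemma derives_trans: "derives bar X es Z \<Longrightarrow> derives bar Z es' Y \<Longrightarrow> derives bar X (es @ es') Y"
  unfolding derives_def by (blast intro: lder_append)

text \<open>Separate rules for a side without events keep empty lists out of calculational
  chains.\<close>

lemma derives_struct_trans [trans]:
  "derives bar X ([] :: ('v, 'e) event list) Z \<Longrightarrow> derives bar Z (es :: ('v, 'e) event list) Y \<Longrightarrow> derives bar X es Y"
  using derives_trans[of bar X "[]" Z es Y] by simp

lemma derives_trans_struct [trans]:
  "derives bar X (es :: ('v, 'e) event list) Z \<Longrightarrow> derives bar Z ([] :: ('v, 'e) event list) Y \<Longrightarrow> derives bar X es Y"
  using derives_trans[of bar X es Z "[]" Y] by simp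

declare derives_trans [trans]

lemma lstep_ldr: "lstep bar s X es Y \<Longrightarrow> derives bar X es Y"
  unfolding derives_def by (metis append_Nil2 lder_Cons lder_Nil)

lemma lstep_ctx: "lstep bar s X es Y \<Longrightarrow> derives bar (fill c X) es (fill c Y)"
proof (induction rule: lstep.induct)
  case (lstep_struct r d)
  from lstep_ldr[OF lstep.lstep_struct[OF this, of bar "ctx_comp c d"]] show ?case by simp
next
  case (lstep_atomic r P Q d v)
  from lstep_ldr[OF lstep.lstep_atomic[OF this, of "ctx_comp c d" v]] show ?case by simp
qed

lemma derives_ctx:
  assumes "derives bar X es Y" shows "derives bar (fill c X) es (fill c Y)"
proof -
  have "derives bar (fill c X) es (fill c Y)" if "lder bar ss X es Y" for ss
    using that by (induction rule: lder.induct) (auto intro: derives_trans lstep_ctx)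
  then show ?thesis using assms unfolding derives_def[of bar X] by blast
qed

lemmas derives_OrL = derives_ctx[of _ _ _ _ "OrL Hole _", simplified]
  and derives_OrR = derives_ctx[of _ _ _ _ "OrR _ Hole", simplified]
  and derives_AndL = derives_ctx[of _ _ _ _ "AndL Hole _", simplified]
  and derives_AndR = derives_ctx[of _ _ _ _ "AndR _ Hole", simplified]

lemma derives_struct: "\<not> atomic r \<Longrightarrow> derives bar (prem id r) [] (concl id r)"
  using lstep_ldr[OF lstep_struct[of r bar Hole]] by simp

lemma derives_atomic: "atomic r \<Longrightarrow> map_fm fst P = prem bar r \<Longrightarrow> map_fm fst Q = concl bar r \<Longrightarrow>
    derives bar P [(v, lblof r, labs P, labs Q)] Q"
  using lstep_ldr[OF lstep_atomic[of r P bar Q Hole v]] by simp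

section \<open>Structural rules, deep switches and general (co)contraction\<close>

lemma derives_rules:
  "derives bar (And x (Or y z)) [] (Or (And x y) z)"
  "derives bar (Or (And x y) (And z w)) [] (And (Or x z) (Or y w))"
  "derives bar (Or x y) [] (Or y x)"
  "derives bar (And x y) [] (And y x)"
  "derives bar (Or (Or x y) z) [] (Or x (Or y z))"
  "derives bar (Or x (Or y z)) [] (Or (Or x y) z)"
  "derives bar (And (And x y) z) [] (And x (And y z))"
  "derives bar (And x (And y z)) [] (And (And x y) z)"
  "derives bar (Or x FF) [] x" "derives bar x [] (Or x FF)"
  "derives bar (And x TT) [] x" "derives bar x [] (And x TT)"
  "derives bar (Or TT TT) [] TT" "derives bar TT [] (Or TT TT)"
  "derives bar (And FF FF) [] FF" "derives bar FF [] (And FF FF)"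
  using derives_struct[of "RSw x y z" bar] derives_struct[of "RMed x y z w" bar]
    derives_struct[of "EOrComm x y" bar] derives_struct[of "EAndComm x y" bar]
    derives_struct[of "EOrAs1 x y z" bar] derives_struct[of "EOrAs2 x y z" bar]
    derives_struct[of "EAndAs1 x y z" bar] derives_struct[of "EAndAs2 x y z" bar]
    derives_struct[of "EOrU1 x" bar] derives_struct[of "EOrU2 x" bar]
    derives_struct[of "EAndU1 x" bar] derives_struct[of "EAndU2 x" bar]
    derives_struct[of ETT1 bar] derives_struct[of ETT2 bar] derives_struct[of EFF1 bar] derives_struct[of EFF2 bar]
  by simp_all

lemmas switch = derives_rules(1) and medial = derives_rules(2)
  and or_comm = derives_rules(3) and and_comm = derives_rules(4)
  and or_assoc = derives_rules(5,6) and and_assoc = derives_rules(7,8)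
  and or_unit = derives_rules(9,10) and and_unit = derives_rules(11,12)

lemma or_swap_right: "derives bar (Or (Or x y) z) [] (Or (Or x z) y)"
  by (rule derives_struct_trans[OF or_assoc(1)], rule derives_struct_trans[OF derives_OrR[OF or_comm]],
      rule or_assoc(2))

lemma and_swap_right: "derives bar (And (And x y) z) [] (And (And x z) y)"
  by (rule derives_struct_trans[OF and_assoc(1)], rule derives_struct_trans[OF derives_AndR[OF and_comm]],
      rule and_assoc(2))

lemma or_exchange: "derives bar (Or (Or x y) (Or z w)) [] (Or (Or x z) (Or y w))"
  by (rule derives_struct_trans[OF or_assoc(2)], rule derives_struct_trans[OF derives_OrL[OF or_swap_right]],
      rule or_assoc(1))

lemma and_exchange: "derives bar (And (And x y) (And z w)) [] (And (And x z) (And y w))"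
  by (rule derives_struct_trans[OF and_assoc(2)], rule derives_struct_trans[OF derives_AndL[OF and_swap_right]],
      rule and_assoc(1))

lemma switch_left: "derives bar (And (Or x z) y) [] (Or (And x y) z)"
  by (rule derives_struct_trans[OF and_comm], rule derives_struct_trans[OF switch], rule derives_OrL[OF and_comm])

text \<open>On its way out \<open>z\<close> passes disjunctions by associativity and commutativity
  and conjunctions by a switch, leaving the unit of disjunction in the hole. No vertex
  arises.\<close>

lemma extract_disjunct: "derives bar (fill c z) [] (Or (fill c FF) z)"
proof (induction c)
  case Hole
  show ?case using derives_struct_trans[OF or_unit(2) or_comm] by simp
next
  case (OrL c b)
  show ?case using derives_struct_trans[OF derives_OrL[OF OrL] or_swap_right] by simp
next
  case (OrR a c)
  show ?case using derives_struct_trans[OF derives_OrR[OF OrR] or_assoc(2)] by simp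
next
  case (AndL c b)
  show ?case using derives_struct_trans[OF derives_AndL[OF AndL] switch_left] by simp
next
  case (AndR a c)
  show ?case using derives_struct_trans[OF derives_AndR[OF AndR] switch] by simp
qed

text \<open>Dually, a switch carries the conjunct into a disjunction, until it meets the unit of
  conjunction in the hole.\<close>

lemma insert_conjunct: "derives bar (And (fill c TT) z) [] (fill c z)"
proof (induction c)
  case Hole
  show ?case using derives_struct_trans[OF and_comm and_unit(1)] by simp
next
  case (OrL c b)
  show ?case using derives_struct_trans[OF switch_left derives_OrL[OF OrL]] by simp
next
  case (OrR a c)
  from derives_struct_trans[OF and_comm derives_struct_trans[OF derives_AndR[OF or_comm]
      derives_struct_trans[OF switch derives_struct_trans[OF derives_OrL[OF and_comm]
      derives_struct_trans[OF derives_OrL[OF OrR] or_comm]]]]]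
  show ?case by simp
next
  case (AndL c b)
  show ?case using derives_struct_trans[OF and_swap_right derives_AndL[OF AndL]] by simp
next
  case (AndR a c)
  show ?case using derives_struct_trans[OF and_assoc(1) derives_AndR[OF AndR]] by simp
qed

text \<open>Copying a formula reduces to copying atoms: the copied halves of a disjunction are
  recombined by medial, those of a conjunction by exchange, and units are copied by structural
  equalities.\<close>

lemma cocontraction:
  "derives bar (relab u X) (map (\<lambda>e. (V e, LCc, [u e], [f e, g e])) (labs X))
     (And (relab f X) (relab g X))"
proof (induction X)
  case (At a)
  then show ?case
    using derives_atomic[of "RCc (fst a)" "At (apsnd u a)" bar
      "And (At (apsnd f a)) (At (apsnd g a))" "V (snd a)"] by simp
next
  case (Or X Y)
  from derives_trans_struct[OF derives_trans[OF derives_OrL[OF Or.IH(1)] derives_OrR[OF Or.IH(2)]] medial]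
  show ?case by simp
next
  case (And X Y)
  from derives_trans_struct[OF derives_trans[OF derives_AndL[OF And.IH(1)] derives_AndR[OF And.IH(2)]] and_exchange]
  show ?case by simp
qed (simp_all add: derives_rules)

text \<open>Dual to \<open>cocontraction\<close>: exchange now serves disjunctions and medial
  conjunctions, before the halves are contracted.\<close>

lemma contraction:
  "derives bar (Or (relab f X) (relab g X)) (map (\<lambda>e. (V e, LCtr, [f e, g e], [u e])) (labs X))
     (relab u X)"
proof (induction X)
  case (At a)
  then show ?case
    using derives_atomic[of "RC (fst a)" "Or (At (apsnd f a)) (At (apsnd g a))" bar
      "At (apsnd u a)" "V (snd a)"] by simp
next
  case (Or X Y)
  from derives_struct_trans[OF or_exchange derives_trans[OF derives_OrL[OF Or.IH(1)] derives_OrR[OF Or.IH(2)]]]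
  show ?case by simp
next
  case (And X Y)
  from derives_struct_trans[OF medial derives_trans[OF derives_AndL[OF And.IH(1)] derives_AndR[OF And.IH(2)]]]
  show ?case by simp
qed (simp_all add: derives_rules)

section \<open>Substituting a formula for an edge\<close>

text \<open>Occurrences are selected by edge and not by atom, so that other occurrences of the same
  atom survive.\<close>

fun subst_edge :: "'e \<Rightarrow> ('a \<times> 'e) fm \<Rightarrow> ('a \<times> 'e) fm \<Rightarrow> ('a \<times> 'e) fm" where
  "subst_edge e t (At a) = (if snd a = e then t else At a)"
| "subst_edge e t (Or x y) = Or (subst_edge e t x) (subst_edge e t y)"
| "subst_edge e t (And x y) = And (subst_edge e t x) (subst_edge e t y)"
| "subst_edge e t FF = FF"
| "subst_edge e t TT = TT"

fun subst_edge_ctx :: "'e \<Rightarrow> ('a \<times> 'e) fm \<Rightarrow> ('a \<times> 'e) ctx \<Rightarrow> ('a \<times> 'e) ctx" where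
  "subst_edge_ctx e t Hole = Hole"
| "subst_edge_ctx e t (OrL c b) = OrL (subst_edge_ctx e t c) (subst_edge e t b)"
| "subst_edge_ctx e t (OrR a c) = OrR (subst_edge e t a) (subst_edge_ctx e t c)"
| "subst_edge_ctx e t (AndL c b) = AndL (subst_edge_ctx e t c) (subst_edge e t b)"
| "subst_edge_ctx e t (AndR a c) = AndR (subst_edge e t a) (subst_edge_ctx e t c)"

lemma subst_edge_fill: "subst_edge e t (fill c x) = fill (subst_edge_ctx e t c) (subst_edge e t x)"
  by (induction c) auto

lemma subst_edge_idle: "e \<notin> set (labs X) \<Longrightarrow> subst_edge e t X = X"
  by (induction X) auto

lemma subst_edge_ctx_idle: "e \<notin> set (ctx_labs c) \<Longrightarrow> subst_edge_ctx e t c = c"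
  by (induction c) (auto simp: subst_edge_idle)

lemma derives_subst_edge_struct: "\<not> atomic r \<Longrightarrow> derives bar (subst_edge e t (prem id r)) [] (subst_edge e t (concl id r))"
  by (cases r) (auto intro: derives_rules)

lemma lstep_subst_edge:
  assumes "lstep bar s X es Y" "e \<notin> set (ins es)" "e \<notin> set (outs es)"
  shows "derives bar (subst_edge e t X) es (subst_edge e t Y)"
  using assms
proof (induction rule: lstep.induct)
  case (lstep_struct r c)
  then show ?case unfolding subst_edge_fill by (intro derives_ctx derives_subst_edge_struct)
next
  case (lstep_atomic r P Q c v)
  then have "subst_edge e t P = P" "subst_edge e t Q = Q" by (simp_all add: subst_edge_idle)
  then show ?case unfolding subst_edge_fill
    using lstep_atomic by (auto intro: derives_ctx derives_atomic)
qed

text \<open>Structural rules remain instances of themselves when a formula replaces an atom, and the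
  redex of an event is untouched because the edge is not incident to it. The interior of a simple
  edge is such a stretch.\<close>

lemma derives_subst_edge:
  assumes "derives bar X es Y" "e \<notin> set (ins es)" "e \<notin> set (outs es)"
  shows "derives bar (subst_edge e t X) es (subst_edge e t Y)"
proof -
  have "derives bar (subst_edge e t X) es (subst_edge e t Y)" if "lder bar ss X es Y" for ss
    using that assms(2,3)
    by (induction rule: lder.induct) (auto intro!: derives_trans lstep_subst_edge)
  then show ?thesis using assms(1) unfolding derives_def[of bar X] by blast
qed

lemma derives_labels:
  assumes "derives bar X es Y"
  shows "set (labs X) \<union> set (outs es) = set (labs Y) \<union> set (ins es)"
    "distinct (labs X @ outs es) \<longleftrightarrow> distinct (labs Y @ ins es)"
  using assms lder_labels unfolding derives_def by blast+

lemma derives_relab: "derives bar X es Y \<Longrightarrow>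
    derives bar (relab g X) (map (relab_event h g) es) (relab g Y)"
  unfolding derives_def using lder_relab by blast

text \<open>Only an event can put an atom on an edge, so an edge carries one atom all along. Hence
  the two ends of a simple edge act on the same atom.\<close>

lemma derives_atom_origin:
  assumes "derives bar X es Y" "(a, e) \<in> set (atoms Y)" "e \<notin> set (outs es)"
  shows "(a, e) \<in> set (atoms X)"
proof -
  have st: "(a, e) \<in> set (atoms X)"
    if "lstep bar s X es Y" "(a, e) \<in> set (atoms Y)" "e \<notin> set (outs es)" for s X es Y
    using that
  proof (induction rule: lstep.induct)
    case (lstep_struct r c)
    then show ?case
      using mset_eq_setD[OF mset_atoms_prem[of r id]] set_atoms_fill[of c "prem id r"]
        set_atoms_fill[of c "concl id r"] by simp
  next
    case (lstep_atomic r P Q c v)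
    then show ?case using set_atoms_fill[of c P] set_atoms_fill[of c Q] by force
  qed
  have "(a, e) \<in> set (atoms X)" if "lder bar ss X es Y" for ss
    using that assms(2,3) by (induction rule: lder.induct) (auto dest: st simp del: set_atoms)
  then show ?thesis using assms(1) unfolding derives_def by blast
qed

section \<open>Opening a derivation at an interaction and a cut\<close>

text \<open>A step contributes at most one event, so each entry of the event list marks a place
  where the derivation can be cut open.\<close>

lemma derives_split_event:
  assumes "derives bar X (es1 @ ev # es2) Y"
  obtains s Z Z' where "derives bar X es1 Z" "lstep bar s Z [ev] Z'" "derives bar Z' es2 Y"
proof -
  have "\<exists>s Z Z'. derives bar X es1 Z \<and> lstep bar s Z [ev] Z' \<and> derives bar Z' es2 Y"
    if "lder bar ss X es Y" "es = es1 @ ev # es2" for ss es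
    using that
  proof (induction arbitrary: es1 rule: lder.induct)
    case (lder_Cons s X es Z ss es' Y)
    note st = lder_Cons.hyps(1) and IH = lder_Cons.IH
    consider "es = []" | ev' where "es = [ev']" using st by (cases rule: lstep.cases) auto
    then show ?case
    proof cases
      case 1
      then show ?thesis
        using IH[of es1] lder_Cons.prems lstep_ldr[OF st] by (auto intro: derives_struct_trans)
    next
      case (2 ev')
      show ?thesis
      proof (cases es1)
        case Nil
        then have "ev' = ev" "es' = es2" using 2 lder_Cons.prems by auto
        then show ?thesis using st lder_Cons.hyps(2) 2 Nil derives_refl unfolding derives_def by blast
      next
        case (Cons ev1 es1')
        then have "es = [ev1]" "es' = es1' @ ev # es2" using 2 lder_Cons.prems by auto
        then show ?thesis
          using IH[of es1'] derives_trans[OF lstep_ldr[OF st], of es1'] Cons by fastforce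
      qed
    qed
  qed simp
  then show thesis using assms that unfolding derives_def[of bar X "es1 @ ev # es2"] by blast
qed

lemma map_fst_eq:
  "map_fm fst P = TT \<longleftrightarrow> P = TT" "map_fm fst P = FF \<longleftrightarrow> P = FF"
  "map_fm fst P = At a \<longleftrightarrow> (\<exists>e. P = At (a, e))"
  "map_fm fst P = Or x y \<longleftrightarrow> (\<exists>x' y'. P = Or x' y' \<and> map_fm fst x' = x \<and> map_fm fst y' = y)"
  "map_fm fst P = And x y \<longleftrightarrow> (\<exists>x' y'. P = And x' y' \<and> map_fm fst x' = x \<and> map_fm fst y' = y)"
  by (cases P; auto)+

text \<open>The edge \<open>e\<close> may be either disjunct. If it is the second, commutativity
  swaps the two and the involution turns \<open>a\<close> into \<open>bar (bar a)\<close>; later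
  only the case with \<open>e\<close> in front remains.\<close>

lemma lstep_interaction:
  fixes Z Z' :: "('a \<times> 'e) fm" and v :: 'v
  assumes "lstep bar s Z [(v, LInt, i, out)] Z'" "e \<in> set out" "\<forall>a. bar (bar a) = a"
  shows "\<exists>c a e'. i = [] \<and> (out = [e, e'] \<or> out = [e', e]) \<and> Z = fill c TT \<and>
    derives bar (fill c (Or (At (a, e)) (At (bar a, e')))) ([] :: ('v, 'e) event list) Z'"
  using assms(1)
proof (cases rule: lstep.cases)
  case (lstep_atomic r P Q c)
  then obtain a where r: "r = RI a" by (cases r) auto
  have P: "P = TT" using lstep_atomic r by (simp add: map_fst_eq)
  obtain e1 e2 where Q: "Q = Or (At (a, e1)) (At (bar a, e2))"
    using lstep_atomic r by (auto simp: map_fst_eq)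
  have io: "i = []" "out = [e1, e2]" "Z = fill c TT" using lstep_atomic P Q by auto
  consider "e = e1" | "e = e2" using assms(2) io by auto
  then show ?thesis
  proof cases
    case 1
    then show ?thesis using lstep_atomic io Q
      by (intro exI[of _ c] exI[of _ a] exI[of _ e2]) simp
  next
    case 2
    then show ?thesis using lstep_atomic io Q assms(3)
      by (intro exI[of _ c] exI[of _ "bar a"] exI[of _ e1]) (simp add: derives_ctx or_comm)
  qed
qed

text \<open>As for interactions, with the commutativity now placed before the cut.\<close>

lemma lstep_cut:
  fixes Z Z' :: "('a \<times> 'e) fm" and v :: 'v
  assumes "lstep bar s Z [(v, LCut, i, out)] Z'" "e \<in> set i" "\<forall>a. bar (bar a) = a"
  shows "\<exists>c a e'. out = [] \<and> (i = [e, e'] \<or> i = [e', e]) \<and> Z' = fill c FF \<and>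
    derives bar Z ([] :: ('v, 'e) event list) (fill c (And (At (a, e)) (At (bar a, e'))))"
  using assms(1)
proof (cases rule: lstep.cases)
  case (lstep_atomic r P Q c)
  then obtain a where r: "r = RCut a" by (cases r) auto
  have Q: "Q = FF" using lstep_atomic r by (simp add: map_fst_eq)
  obtain e1 e2 where P: "P = And (At (a, e1)) (At (bar a, e2))"
    using lstep_atomic r by (auto simp: map_fst_eq)
  have io: "out = []" "i = [e1, e2]" "Z' = fill c FF" using lstep_atomic P Q by auto
  consider "e = e1" | "e = e2" using assms(2) io by auto
  then show ?thesis
  proof cases
    case 1
    then show ?thesis using lstep_atomic io P
      by (intro exI[of _ c] exI[of _ a] exI[of _ e2]) simp
  next
    case 2
    then show ?thesis using lstep_atomic io P assms(3)
      by (intro exI[of _ c] exI[of _ "bar a"] exI[of _ e1]) (simp add: derives_ctx and_comm)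
  qed
qed

lemma ctx_atoms_map [simp]: "ctx_atoms (map_ctx f c) = map f (ctx_atoms c)"
  by (induction c) auto

lemma upper_realizes: "realizes F X es Y \<Longrightarrow> upper F = set (labs X)"
proof -
  assume F: "realizes F X es Y"
  have "fup F e \<noteq> None" if "e \<in> set (outs es)" for e
    using that realizes_event(4)[OF F] unfolding in_outs by fastforce
  then show ?thesis
    using realizesD(4,5)[OF F] unfolding upper_def set_append by blast
qed

lemma lower_realizes: "realizes F X es Y \<Longrightarrow> derives bar X es Y \<Longrightarrow> lower F = set (labs Y)"
proof -
  assume F: "realizes F X es Y" and d: "derives bar X es Y"
  have "flo F e \<noteq> None" if "e \<in> set (ins es)" for e
    using that realizes_event(3)[OF F] unfolding in_ins by fastforce
  then show ?thesis
    using realizesD(4,6)[OF F] derives_labels(1)[OF d] unfolding lower_def set_append by blast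
qed

text \<open>Only the middle stretch contains \<open>e\<close>; the outer ones are kept. The
  weakening starts from the unit in \<open>Or TT FF\<close>, and what is left at the cut is freed
  from its context before the last stretch runs beside it.\<close>

lemma left_derivation:
  assumes "derives bar X es1 (fill c1 TT)"
    and "derives bar (fill c1 (Or (At (a, e)) (At (b, e2)))) es2 (fill c2 (And (At (a, e)) (At (b, e3))))"
    and "derives bar (fill c2 FF) es3 Y"
    and "e \<notin> set (ctx_labs c1)" "e \<notin> set (ctx_labs c2)" "e \<noteq> e2" "e \<noteq> e3"
    and "e \<notin> set (ins es2)" "e \<notin> set (outs es2)"
  shows "derives bar X (es1 @ (w, LW, [], [e2]) # es2 @ es3) (Or Y (At (b, e3)))"
proof -
  have w: "derives bar (fill c1 TT) [(w, LW, [], [e2])] (fill c1 (Or TT (At (b, e2))))"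
    using derives_ctx[OF derives_struct_trans[OF or_unit(2) derives_OrR[OF derives_atomic[of "RW b" FF bar "At (b, e2)" w]]]]
    by simp
  \<comment> \<open>Freshness of \<open>e\<close> in both contexts ensures that the substitution
    hits the displayed atoms alone.\<close>
  have "derives bar (fill c1 (Or TT (At (b, e2)))) es2 (fill c2 (And TT (At (b, e3))))"
    using derives_subst_edge[OF assms(2,8,9), of TT] assms(4-7) by (simp add: subst_edge_fill subst_edge_ctx_idle)
  also have "derives bar (fill c2 (And TT (At (b, e3)))) [] (fill c2 (At (b, e3)))"
    by (rule derives_ctx[OF derives_struct_trans[OF and_comm and_unit(1)]])
  also have "derives bar (fill c2 (At (b, e3))) [] (Or (fill c2 FF) (At (b, e3)))"
    by (rule extract_disjunct)
  also have "derives bar (Or (fill c2 FF) (At (b, e3))) es3 (Or Y (At (b, e3)))"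
    by (rule derives_OrL[OF assms(3)])
  finally show ?thesis using derives_trans[OF derives_trans[OF assms(1) w]] by fastforce
qed

text \<open>The additional premiss waits beside \<open>es1\<close>, then sinks to the place of the
  interaction and becomes its second atom, with \<open>FF\<close> as the first. At the cut,
  coweakening turns the remaining conjunction into \<open>And FF TT\<close>, that is
  \<open>FF\<close>.\<close>

lemma right_derivation:
  assumes "derives bar X es1 (fill c1 TT)"
    and "derives bar (fill c1 (Or (At (a, e)) (At (b, e2)))) es2 (fill c2 (And (At (a, e)) (At (b, e3))))"
    and "derives bar (fill c2 FF) es3 Y"
    and "e \<notin> set (ctx_labs c1)" "e \<notin> set (ctx_labs c2)" "e \<noteq> e2" "e \<noteq> e3"
    and "e \<notin> set (ins es2)" "e \<notin> set (outs es2)"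
  shows "derives bar (And X (At (b, e2))) (es1 @ es2 @ (w, LCw, [e3], []) # es3) Y"
proof -
  have w: "derives bar (fill c2 (And FF (At (b, e3)))) [(w, LCw, [e3], [])] (fill c2 FF)"
    using derives_ctx[OF derives_trans_struct[OF derives_AndR[OF derives_atomic[of "RCw b" "At (b, e3)" bar TT w]] and_unit(1)]]
    by simp
  have "derives bar (And X (At (b, e2))) es1 (And (fill c1 TT) (At (b, e2)))"
    by (rule derives_AndL[OF assms(1)])
  also have "derives bar (And (fill c1 TT) (At (b, e2))) [] (fill c1 (At (b, e2)))"
    by (rule insert_conjunct)
  also have "derives bar (fill c1 (At (b, e2))) [] (fill c1 (Or FF (At (b, e2))))"
    by (rule derives_ctx[OF derives_struct_trans[OF or_unit(2) or_comm]])
  also have "derives bar (fill c1 (Or FF (At (b, e2)))) es2 (fill c2 (And FF (At (b, e3))))"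
    using derives_subst_edge[OF assms(2,8,9), of FF] assms(4-7) by (simp add: subst_edge_fill subst_edge_ctx_idle)
  finally show ?thesis using derives_trans[OF derives_trans[OF _ w] assms(3)] by fastforce
qed

text \<open>The sibling edges \<open>e2\<close> and \<open>e3\<close> may coincide: an interaction
  and a cut can be joined by both of their edges.\<close>

lemma simple_edge_decompose:
  fixes B :: "('v, 'e) flow"
  assumes inv: "\<forall>a. bar (bar a) = a" and d: "derives bar X es Y" and B: "realizes B X es Y"
    and e: "simple_edge B e"
  obtains es1 es2 es3 i k o1 i1 c1 c2 a e2 e3 where
    "es = es1 @ (i, LInt, [], o1) # es2 @ (k, LCut, i1, []) # es3"
    "o1 = [e, e2] \<or> o1 = [e2, e]" "i1 = [e, e3] \<or> i1 = [e3, e]"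
    "fup B e = Some i" "flo B e = Some k"
    "derives bar X es1 (fill c1 TT)"
    "derives bar (fill c1 (Or (At (a, e)) (At (bar a, e2)))) es2 (fill c2 (And (At (a, e)) (At (bar a, e3))))"
    "derives bar (fill c2 FF) es3 Y"
    "e \<notin> set (ctx_labs c1)" "e \<notin> set (ctx_labs c2)" "e \<noteq> e2" "e \<noteq> e3"
    "e \<notin> set (ins es2)" "e \<notin> set (outs es2)"
proof -
  obtain i k where ik: "fup B e = Some i" "flo B e = Some k" "flab B i = LInt" "flab B k = LCut"
    and eE: "e \<in> fE B" using e unfolding simple_edge_def by blast
  note dist = realizesD(3)[OF B]
  have dist': "distinct (labs Y @ ins es)" using derives_labels(2)[OF d] dist by blast
  have "e \<in> set (outs es)" using eE ik(1) realizesD(4,5)[OF B] by (metis UnE option.distinct(1) set_append)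
  then obtain i0 o1 where i_in: "(i, LInt, i0, o1) \<in> set es" "e \<in> set o1"
    using ik(1,3) realizes_event(2,4)[OF B] unfolding in_outs by (metis option.inject)
  have "e \<in> set (ins es)"
    using eE ik(2) realizesD(4,6)[OF B] derives_labels(1)[OF d] by (metis UnE option.distinct(1) set_append)
  then obtain i1 k0 where k_in: "(k, LCut, i1, k0) \<in> set es" "e \<in> set i1"
    using ik(2,4) realizes_event(2,3)[OF B] unfolding in_ins by (metis option.inject)
  obtain es1 D where D: "es = es1 @ (i, LInt, i0, o1) # D"
    using split_list[OF i_in(1)] by blast
  obtain s1 Z1 Z1' where Z1: "derives bar X es1 Z1" "lstep bar s1 Z1 [(i, LInt, i0, o1)] Z1'" "derives bar Z1' D Y"
    using derives_split_event[OF d[unfolded D]] by blast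
  obtain c1 a e2 where c1: "i0 = []" "o1 = [e, e2] \<or> o1 = [e2, e]" "Z1 = fill c1 TT"
    "derives bar (fill c1 (Or (At (a, e)) (At (bar a, e2)))) ([] :: ('v, 'e) event list) Z1'"
    using lstep_interaction[OF Z1(2) i_in(2) inv] by blast
  have e_new: "e \<notin> set (labs X)" "e \<notin> set (outs es1)" "e \<notin> set (outs D)" "e \<noteq> e2"
    using dist c1(2) unfolding D by auto
  have e_new': "e \<notin> set (ins es1)" "e \<notin> set (labs (fill c1 TT))"
    using e_new derives_labels(1)[OF Z1(1)] c1(3) by blast+
  \<comment> \<open>Before the interaction \<open>e\<close> does not exist, so the cut that consumes
    it comes later.\<close>
  have "(k, LCut, i1, k0) \<notin> set es1" using k_in(2) e_new'(1) in_ins by metis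
  then have "(k, LCut, i1, k0) \<in> set D" using k_in(1) D by auto
  then obtain es2 es3 where es2: "D = es2 @ (k, LCut, i1, k0) # es3" using split_list by metis
  obtain s2 Z2 Z2' where Z2: "derives bar Z1' es2 Z2" "lstep bar s2 Z2 [(k, LCut, i1, k0)] Z2'" "derives bar Z2' es3 Y"
    using derives_split_event[OF Z1(3)[unfolded es2]] by blast
  obtain c2 a' e3 where c2: "k0 = []" "i1 = [e, e3] \<or> i1 = [e3, e]" "Z2' = fill c2 FF"
    "derives bar Z2 ([] :: ('v, 'e) event list) (fill c2 (And (At (a', e)) (At (bar a', e3))))"
    using lstep_cut[OF Z2(2) k_in(2) inv] by blast
  let ?P = "fill c1 (Or (At (a, e)) (At (bar a, e2)))"
  let ?Q = "fill c2 (And (At (a', e)) (At (bar a', e3)))"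
  have PQ: "derives bar ?P es2 ?Q"
    by (rule derives_struct_trans[OF c1(4) derives_trans_struct[OF Z2(1) c2(4)]])
  have e_es2: "e \<notin> set (outs es2)" "e \<notin> set (ins es2)" "e \<noteq> e3"
    using e_new(3) dist' c2(2) unfolding D es2 by auto
  have ec1: "e \<notin> set (ctx_labs c1)"
    using e_new'(2) set_atoms_fill[of c1 TT] by auto
  \<comment> \<open>Below the interaction \<open>e\<close> occurs exactly once, and
    \<open>es2\<close> neither creates nor consumes it. The displayed atom at the cut is therefore
    its only occurrence there, and the context \<open>c2\<close> is free of it.\<close>
  have "count (mset (labs ?P)) e = 1"
    using ec1 e_new(4) unfolding mset_labs_fill by (simp add: count_mset_0_iff flip: mset_map)
  moreover have "mset (labs ?P) + mset (outs es2) = mset (labs ?Q) + mset (ins es2)"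
    using PQ lder_conserve unfolding derives_def by blast
  from arg_cong[OF this, of "\<lambda>M. count M e"] have "count (mset (labs ?P)) e = count (mset (labs ?Q)) e"
    by (simp only: count_union e_es2(1,2)[folded count_mset_0_iff] add_0_right)
  ultimately have "count (mset (ctx_labs c2)) e = 0"
    unfolding mset_labs_fill by (simp split: if_splits)
  then have ec2: "e \<notin> set (ctx_labs c2)" by (simp only: count_mset_0_iff not_False_eq_True)
  have "(a', e) \<in> set (atoms ?Q)" using set_atoms_fill by fastforce
  then have "(a', e) \<in> set (atoms ?P)" using derives_atom_origin[OF PQ] e_es2 by blast
  then have "a' = a" using ec1 e_new(4) set_atoms_fill[of c1 "Or (At (a, e)) (At (bar a, e2))"] by force
  show thesis
    by (rule that[of es1 i o1 es2 k i1 es3 e2 e3 c1 a c2])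
      (use D es2 c1 c2 ik Z1 Z2 PQ \<open>a' = a\<close> ec1 ec2 e_new e_es2 in auto)
qed

section \<open>Splitting\<close>

text \<open>\<open>ren\<close> reads labels and ends through the inverse of the tag, which cancels
  by injectivity.\<close>

lemma splitL_simps:
  assumes "fup B e = Some i" "flo B e = Some k"
  shows "fV (splitL B e) = insert Nw (Tl ` (fV B - {i, k}))"
    "fE (splitL B e) = Tl ` (fE B - {e})"
    "flab (splitL B e) Nw = LW" "flab (splitL B e) (Tl v) = flab B v"
    "fup (splitL B e) (Tl x) = (if x = e2_of B e then Some Nw
       else if fup B x = Some i then None else map_option Tl (fup B x))"
    "flo (splitL B e) (Tl x) = (if flo B x = Some k then None else map_option Tl (flo B x))"
proof -
  have [simp]: "inv Tl (Tl x) = x" for x by (rule inv_f_f) (simp add: inj_def)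
  show "fV (splitL B e) = insert Nw (Tl ` (fV B - {i, k}))"
    "fE (splitL B e) = Tl ` (fE B - {e})"
    "flab (splitL B e) Nw = LW" "flab (splitL B e) (Tl v) = flab B v"
    "fup (splitL B e) (Tl x) = (if x = e2_of B e then Some Nw
       else if fup B x = Some i then None else map_option Tl (fup B x))"
    "flo (splitL B e) (Tl x) = (if flo B x = Some k then None else map_option Tl (flo B x))"
    by (simp_all add: splitL_def ren_def delA_def Let_def assms)
qed

lemma splitR_simps:
  assumes "fup B e = Some i" "flo B e = Some k"
  shows "fV (splitR B e) = insert Ncw (Ht ` (fV B - {i, k}))"
    "fE (splitR B e) = Ht ` (fE B - {e})"
    "flab (splitR B e) Ncw = LCw" "flab (splitR B e) (Ht v) = flab B v"
    "fup (splitR B e) (Ht x) = (if fup B x = Some i then None else map_option Ht (fup B x))"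
    "flo (splitR B e) (Ht x) = (if x = e3_of B e then Some Ncw
       else if flo B x = Some k then None else map_option Ht (flo B x))"
proof -
  have [simp]: "inv Ht (Ht x) = x" for x by (rule inv_f_f) (simp add: inj_def)
  show "fV (splitR B e) = insert Ncw (Ht ` (fV B - {i, k}))"
    "fE (splitR B e) = Ht ` (fE B - {e})"
    "flab (splitR B e) Ncw = LCw" "flab (splitR B e) (Ht v) = flab B v"
    "fup (splitR B e) (Ht x) = (if fup B x = Some i then None else map_option Ht (fup B x))"
    "flo (splitR B e) (Ht x) = (if x = e3_of B e then Some Ncw
       else if flo B x = Some k then None else map_option Ht (flo B x))"
    by (simp_all add: splitR_def ren_def delA_def Let_def assms)
qed

text \<open>A converse of \<open>realizes_event\<close>: distinct vertex names leave one event per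
  vertex, whose list then holds all edges there. This makes \<open>e2_of\<close> well
  defined.\<close>

lemma realizes_out_edge:
  assumes B: "realizes B X es Y" and "(v, l, i, out) \<in> set es" "x \<in> fE B" "fup B x = Some v"
  shows "x \<in> set out"
proof -
  have "x \<in> set (outs es)"
    using assms(3,4) realizesD(4,5)[OF B] by (metis UnE option.distinct(1) set_append)
  then obtain v' l' i' out' where ev: "(v', l', i', out') \<in> set es" "x \<in> set out'"
    unfolding in_outs by blast
  then have "v' = v" using realizes_event(4)[OF B] assms(4) by fastforce
  then have "(v', l', i', out') = (v, l, i, out)"
    using realizesD(1)[OF B] ev(1) assms(2) by (metis eq_key_imp_eq_value)
  then show ?thesis using ev(2) by simp
qed

lemma realizes_in_edge:
  assumes B: "realizes B X es Y" and "derives bar X es Y"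
    and "(v, l, i, out) \<in> set es" "x \<in> fE B" "flo B x = Some v"
  shows "x \<in> set i"
proof -
  have "x \<in> set (ins es)"
    using assms(4,5) realizesD(4,6)[OF B] derives_labels(1)[OF assms(2)]
    by (metis UnE option.distinct(1) set_append)
  then obtain v' l' i' out' where ev: "(v', l', i', out') \<in> set es" "x \<in> set i'"
    unfolding in_ins by blast
  then have "v' = v" using realizes_event(3)[OF B] assms(5) by fastforce
  then have "(v', l', i', out') = (v, l, i, out)"
    using realizesD(1)[OF B] ev(1) assms(3) by (metis eq_key_imp_eq_value)
  then show ?thesis using ev(2) by simp
qed

context
  fixes bar :: "'a \<Rightarrow> 'a" and B :: "(nm, nm) flow" and X Y :: "('a \<times> nm) fm"
    and es es1 es2 es3 i k o1 i1 e e2 e3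
  assumes B: "realizes B X es Y" and d: "derives bar X es Y"
    and es: "es = es1 @ (i, LInt, [], o1) # es2 @ (k, LCut, i1, []) # es3"
    and o1: "o1 = [e, e2] \<or> o1 = [e2, e]" and i1: "i1 = [e, e3] \<or> i1 = [e3, e]"
    and up: "fup B e = Some i" and lo: "flo B e = Some k"
begin

lemma simple_edge_neq: "e \<noteq> e2" "e \<noteq> e3"
proof -
  have "distinct (labs Y @ ins es)" using realizesD(3)[OF B] derives_labels(2)[OF d] by blast
  then show "e \<noteq> e2" "e \<noteq> e3" using realizesD(3)[OF B] o1 i1 unfolding es by auto
qed

lemma simple_edge_in_E: "e \<in> fE B" "e2 \<in> fE B" "e3 \<in> fE B"
proof -
  have E: "fE B = set (labs X) \<union> set (outs es)" "fE B = set (labs Y) \<union> set (ins es)"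
    using realizesD(4)[OF B] derives_labels(1)[OF d] by auto
  show "e \<in> fE B" "e2 \<in> fE B" unfolding E(1) using o1 unfolding es by auto
  show "e3 \<in> fE B" unfolding E(2) using i1 unfolding es by auto
qed

lemma simple_edge_ends: "fup B e2 = Some i" "flo B e3 = Some k"
proof -
  have "(i, LInt, [], o1) \<in> set es" "(k, LCut, i1, []) \<in> set es" unfolding es by auto
  then show "fup B e2 = Some i" "flo B e3 = Some k"
    using realizes_event(3,4)[OF B] o1 i1 by fastforce+
qed

lemma e2_of_eq: "e2_of B e = e2"
  unfolding e2_of_def
proof (rule the_equality)
  have *: "(i, LInt, [], o1) \<in> set es" unfolding es by simp
  show "e2 \<in> fE B \<and> e2 \<noteq> e \<and> fup B e2 = fup B e" using simple_edge_neq simple_edge_in_E simple_edge_ends up by simp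
  show "x = e2" if "x \<in> fE B \<and> x \<noteq> e \<and> fup B x = fup B e" for x
    using realizes_out_edge[OF B *, of x] that o1 up by auto
qed

lemma e3_of_eq: "e3_of B e = e3"
  unfolding e3_of_def
proof (rule the_equality)
  have *: "(k, LCut, i1, []) \<in> set es" unfolding es by simp
  show "e3 \<in> fE B \<and> e3 \<noteq> e \<and> flo B e3 = flo B e" using simple_edge_neq simple_edge_in_E simple_edge_ends lo by simp
  show "x = e3" if "x \<in> fE B \<and> x \<noteq> e \<and> flo B x = flo B e" for x
    using realizes_in_edge[OF B d *, of x] that i1 lo by auto
qed

lemma other_events:
  assumes "(v, l, j, out) \<in> set es1 \<union> set es2 \<union> set es3"
  shows "v \<noteq> i" "v \<noteq> k" "flab B v = l" "x \<in> set j \<Longrightarrow> flo B x = Some v"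
    "x \<in> set out \<Longrightarrow> fup B x = Some v"
proof -
  have "v \<in> set (map fst es1) \<union> set (map fst es2) \<union> set (map fst es3)" using assms by force
  then show "v \<noteq> i" "v \<noteq> k" using realizesD(1)[OF B] unfolding es by auto
  have "(v, l, j, out) \<in> set es" using assms unfolding es by auto
  then show "flab B v = l" "x \<in> set j \<Longrightarrow> flo B x = Some v" "x \<in> set out \<Longrightarrow> fup B x = Some v"
    using realizes_event[OF B] by blast+
qed

text \<open>The events are those of \<open>left_derivation\<close>: the weakening replaces the
  interaction and the cut is gone. The atom \<open>b\<close> is arbitrary because
  \<open>realizes\<close> looks at labels only.\<close>

lemma realizes_splitL:
  "realizes (splitL B e) (relab Tl X)
    (map (relab_event Tl Tl) es1 @ (Nw, LW, [], [Tl e2]) #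
      map (relab_event Tl Tl) es2 @ map (relab_event Tl Tl) es3)
    (Or (relab Tl Y) (At (b, Tl e3)))"
  unfolding realizes_def
proof (intro conjI)
  note S = splitL_simps[OF up lo] and D = realizesD[OF B]
  have inj: "inj_on Tl A" for A by (simp add: inj_on_def)
  let ?es = "map (relab_event Tl Tl) es1 @ (Nw, LW, [], [Tl e2]) #
      map (relab_event Tl Tl) es2 @ map (relab_event Tl Tl) es3"
  have vs: "map fst ?es = map Tl (map fst es1) @ Nw # map Tl (map fst es2 @ map fst es3)" by simp
  show "distinct (map fst ?es)" unfolding vs using D(1) unfolding es
    by (auto simp: distinct_map inj intro: comp_inj_on)
  show "fV (splitL B e) = set (map fst ?es)" unfolding vs S(1) D(2)
    using D(1) unfolding es by (auto simp: image_iff)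
  have ls: "labs (relab Tl X) @ outs ?es = map Tl (labs X @ outs es1 @ e2 # outs es2 @ outs es3)"
    by simp
  have "distinct (labs X @ outs es1 @ e2 # outs es2 @ outs es3)"
    using D(3) o1 unfolding es by auto
  then show "distinct (labs (relab Tl X) @ outs ?es)" unfolding ls by (simp only: distinct_map inj)
  have "fE B - {e} = set (labs X @ outs es1 @ e2 # outs es2 @ outs es3)"
    using D(3) o1 simple_edge_neq unfolding D(4) es by auto
  then show "fE (splitL B e) = set (labs (relab Tl X) @ outs ?es)"
    unfolding ls S(2) by (simp only: set_map)
  \<comment> \<open>An edge of the premiss must not fall under the clause that gives
    \<open>e2\<close> the new weakening as its upper end.\<close>
  have "e2 \<notin> set (labs X)" using D(5)[of e2] simple_edge_ends by (intro notI) simp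
  then show "\<forall>x\<in>set (labs (relab Tl X)). fup (splitL B e) x = None"
    using D(5) by (force simp: S e2_of_eq)
  show "\<forall>x\<in>set (labs (Or (relab Tl Y) (At (b, Tl e3)))). flo (splitL B e) x = None"
    using D(6) simple_edge_ends by (auto simp: S)
  have "flab (splitL B e) (Tl v) = l \<and> (\<forall>x\<in>set (map Tl j). flo (splitL B e) x = Some (Tl v)) \<and>
     (\<forall>x\<in>set (map Tl out). fup (splitL B e) x = Some (Tl v))"
    if "(v, l, j, out) \<in> set es1 \<union> set es2 \<union> set es3" for v l j out
    using other_events[OF that] simple_edge_ends by (auto simp: S e2_of_eq)
  then show "\<forall>(v, l, j, out)\<in>set ?es. flab (splitL B e) v = l \<and>
     (\<forall>x\<in>set j. flo (splitL B e) x = Some v) \<and> (\<forall>x\<in>set out. fup (splitL B e) x = Some v)"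
    by (fastforce simp: S e2_of_eq)
qed

text \<open>Dual: \<open>e2\<close> joins the premiss, and the coweakening on \<open>e3\<close>
  takes the place of the cut.\<close>

lemma realizes_splitR:
  "realizes (splitR B e) (And (relab Ht X) (At (b, Ht e2)))
    (map (relab_event Ht Ht) es1 @ map (relab_event Ht Ht) es2 @
      (Ncw, LCw, [Ht e3], []) # map (relab_event Ht Ht) es3)
    (relab Ht Y)"
  unfolding realizes_def
proof (intro conjI)
  note S = splitR_simps[OF up lo] and D = realizesD[OF B]
  have inj: "inj_on Ht A" for A by (simp add: inj_on_def)
  let ?es = "map (relab_event Ht Ht) es1 @ map (relab_event Ht Ht) es2 @
      (Ncw, LCw, [Ht e3], []) # map (relab_event Ht Ht) es3"
  have vs: "map fst ?es = map Ht (map fst es1 @ map fst es2) @ Ncw # map Ht (map fst es3)" by simp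
  show "distinct (map fst ?es)" unfolding vs using D(1) unfolding es
    by (auto simp: distinct_map inj intro: comp_inj_on)
  show "fV (splitR B e) = set (map fst ?es)" unfolding vs S(1) D(2)
    using D(1) unfolding es by (auto simp: image_iff)
  have ls: "labs (And (relab Ht X) (At (b, Ht e2))) @ outs ?es =
      map Ht (labs X @ e2 # outs es1 @ outs es2 @ outs es3)"
    by simp
  have "distinct (labs X @ e2 # outs es1 @ outs es2 @ outs es3)"
    using D(3) o1 unfolding es by auto
  then show "distinct (labs (And (relab Ht X) (At (b, Ht e2))) @ outs ?es)"
    unfolding ls by (simp only: distinct_map inj)
  have "fE B - {e} = set (labs X @ e2 # outs es1 @ outs es2 @ outs es3)"
    using D(3) o1 simple_edge_neq unfolding D(4) es by auto
  then show "fE (splitR B e) = set (labs (And (relab Ht X) (At (b, Ht e2))) @ outs ?es)"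
    unfolding ls S(2) by (simp only: set_map)
  show "\<forall>x\<in>set (labs (And (relab Ht X) (At (b, Ht e2)))). fup (splitR B e) x = None"
    using D(5) simple_edge_ends by (auto simp: S)
  have "e3 \<notin> set (labs Y)" using D(6)[of e3] simple_edge_ends by (intro notI) simp
  then show "\<forall>x\<in>set (labs (relab Ht Y)). flo (splitR B e) x = None"
    using D(6) by (force simp: S e3_of_eq)
  have "flab (splitR B e) (Ht v) = l \<and> (\<forall>x\<in>set (map Ht j). flo (splitR B e) x = Some (Ht v)) \<and>
     (\<forall>x\<in>set (map Ht out). fup (splitR B e) x = Some (Ht v))"
    if "(v, l, j, out) \<in> set es1 \<union> set es2 \<union> set es3" for v l j out
    using other_events[OF that] simple_edge_ends by (auto simp: S e3_of_eq)
  then show "\<forall>(v, l, j, out)\<in>set ?es. flab (splitR B e) v = l \<and>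
     (\<forall>x\<in>set j. flo (splitR B e) x = Some v) \<and> (\<forall>x\<in>set out. fup (splitR B e) x = Some v)"
    by (fastforce simp: S e3_of_eq)
qed

end

section \<open>Gluing\<close>

lemma mset_outs_cocontractions:
  "mset (outs (map (\<lambda>e. (V e, l, [u e], [f e, g e])) xs)) = mset (map f xs @ map g xs)"
  by (induction xs) auto

lemma outs_contractions: "outs (map (\<lambda>e. (V e, l, [f e, g e], [u e])) xs) = map u xs"
  by (induction xs) auto

context
  fixes bar :: "'a \<Rightarrow> 'a" and B D1 D2 :: "(nm, nm) flow" and X Y :: "('a \<times> nm) fm"
    and es1 es2 :: "(nm, nm) event list" and e b and fu1 fl1 fu2 fl2 u1 l1 u2 l2 g2 g3
  defines "u1 \<equiv> \<lambda>x. fu1 (Tl x)" and "l1 \<equiv> \<lambda>x. fl1 (Tl x)"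
    and "u2 \<equiv> \<lambda>x. fu2 (Ht x)" and "l2 \<equiv> \<lambda>x. fl2 (Ht x)"
    and "g3 \<equiv> fl1 (Tl (e3_of B e))" and "g2 \<equiv> fu2 (Ht (e2_of B e))"
  assumes upB: "upper B = set (labs X)" and loB: "lower B = set (labs Y)"
    and distX: "distinct (labs X)" and distY: "distinct (labs Y)"
    and D1: "realizes D1 (relab u1 X) es1 (Or (relab l1 Y) (At (b, g3)))"
    and d1: "derives bar (relab u1 X) es1 (Or (relab l1 Y) (At (b, g3)))"
    and D2: "realizes D2 (And (relab u2 X) (At (b, g2))) es2 (relab l2 Y)"
    and d2: "derives bar (And (relab u2 X) (At (b, g2))) es2 (relab l2 Y)"
begin

text \<open>The edge \<open>g2\<close> of the right part is identified with the edge \<open>g3\<close> of the left part.\<close>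

definition right_label where "right_label y = (if y = g2 then Lf g3 else Rt y)"

text \<open>Names are dictated by \<open>glue\<close>. The order, which a flow does not record, is
  that of the chain in \<open>derives_glue\<close>.\<close>

definition glued_events :: "(nm, nm) event list" where
  "glued_events = map (\<lambda>e. (Ncc e, LCc, [NU e], [Lf (u1 e), right_label (u2 e)])) (labs X) @
     map (relab_event Lf Lf) es1 @ map (relab_event Rt right_label) es2 @
     map (\<lambda>e. (Nct e, LCtr, [Lf (l1 e), right_label (l2 e)], [NL e])) (labs Y)"

text \<open>The switch passes the additional atom from the conclusion of the left part to the
  premiss of the right part without any vertex, so \<open>g3\<close> and \<open>g2\<close> must be
  one edge, as \<open>right_label\<close> makes them.\<close>

lemma derives_glue: "derives bar (relab NU X) glued_events (relab NL Y)"
proof -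
  let ?X2 = "relab (\<lambda>x. right_label (u2 x)) X"
  let ?Y1 = "relab (\<lambda>x. Lf (l1 x)) Y"
  let ?z = "At (b, Lf g3)"
  let ?es1 = "map (relab_event Lf Lf) es1" and ?es2 = "map (relab_event Rt right_label) es2"
  have co: "derives bar (relab NU X) (map (\<lambda>e. (Ncc e, LCc, [NU e], [Lf (u1 e), right_label (u2 e)])) (labs X))
      (And (relab (\<lambda>x. Lf (u1 x)) X) ?X2)"
    by (rule cocontraction)
  have left: "derives bar (And (relab (\<lambda>x. Lf (u1 x)) X) ?X2) ?es1 (And (Or ?Y1 ?z) ?X2)"
    using derives_AndL[OF derives_relab[OF d1, of Lf Lf]] by simp
  have sw: "derives bar (And (Or ?Y1 ?z) ?X2) ([] :: (nm, nm) event list) (Or ?Y1 (And ?X2 ?z))"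
    by (rule derives_struct_trans[OF derives_AndL[OF or_comm]], rule derives_struct_trans[OF switch_left],
        rule derives_struct_trans[OF or_comm], rule derives_OrR[OF and_comm])
  have right: "derives bar (Or ?Y1 (And ?X2 ?z)) ?es2 (Or ?Y1 (relab (\<lambda>x. right_label (l2 x)) Y))"
    using derives_OrR[OF derives_relab[OF d2, of right_label Rt]] by (simp add: right_label_def[of g2])
  have con: "derives bar (Or ?Y1 (relab (\<lambda>x. right_label (l2 x)) Y))
      (map (\<lambda>e. (Nct e, LCtr, [Lf (l1 e), right_label (l2 e)], [NL e])) (labs Y)) (relab NL Y)"
    by (rule contraction)
  show ?thesis
    unfolding glued_events_def
    by (rule derives_trans[OF co derives_trans[OF left derives_struct_trans[OF sw derives_trans[OF right con]]]])
qed

lemma distinct_left: "distinct (map u1 (labs X) @ outs es1)" "distinct (map l1 (labs Y) @ g3 # ins es1)"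
  using realizesD(3)[OF D1] derives_labels(2)[OF d1] by (simp_all add: comp_def)

lemma distinct_right: "distinct (map u2 (labs X) @ g2 # outs es2)" "distinct (map l2 (labs Y) @ ins es2)"
  using realizesD(3)[OF D2] derives_labels(2)[OF d2] by (simp_all add: comp_def)

text \<open>As a premiss edge \<open>g2\<close> differs from the other premiss edges and from all
  edges started by events. It may still enter an event or reach the conclusion, where
  \<open>right_label\<close> cannot be simplified.\<close>

lemma right_label_Rt: "x \<in> set (labs X) \<Longrightarrow> right_label (u2 x) = Rt (u2 x)" "y \<in> set (outs es2) \<Longrightarrow> right_label y = Rt y"
  using distinct_right(1) by (auto simp: right_label_def)

text \<open>Cocontractions list the two copies alternately; up to order they can be separated into
  the left and the right part, which yields both distinctness and the edge set.\<close>

lemma mset_glued_labels: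
  "mset (map NU (labs X) @ outs glued_events) = mset (map NU (labs X) @
     map Lf (map u1 (labs X) @ outs es1) @ map Rt (map u2 (labs X) @ outs es2) @ map NL (labs Y))"
proof -
  have h: "map (\<lambda>x. right_label (u2 (snd x))) (atoms X) = map (\<lambda>x. Rt (u2 (snd x))) (atoms X)"
    "map right_label (outs es2) = map Rt (outs es2)"
    using right_label_Rt by simp_all
  show ?thesis
    unfolding glued_events_def
    by (simp add: h mset_outs_cocontractions outs_contractions comp_def flip: mset_map)
qed

lemma THE_inj: "inj_on f A \<Longrightarrow> x \<in> A \<Longrightarrow> (THE y. y \<in> A \<and> f y = f x) = x"
  by (rule the_equality) (auto dest: inj_onD)

lemma realizes_glue:
  "realizes (glue B e D1 fu1 fl1 D2 fu2 fl2) (relab NU X) glued_events (relab NL Y)"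
proof -
  let ?G = "glue B e D1 fu1 fl1 D2 fu2 fl2"
  \<comment> \<open>The shared edge is kept as \<open>Lf g3\<close> with the lower end of
    \<open>g2\<close>. Hence lower ends are stated for \<open>right_label x\<close>, and for
    \<open>Lf x\<close> only when \<open>x\<close> is not \<open>g3\<close>.\<close>
  have G:
    "fV ?G = Lf ` fV D1 \<union> Rt ` fV D2 \<union> Ncc ` set (labs X) \<union> Nct ` set (labs Y)"
    "fE ?G = Lf ` fE D1 \<union> Rt ` (fE D2 - {g2}) \<union> NU ` set (labs X) \<union> NL ` set (labs Y)"
    "\<And>v. flab ?G (Lf v) = flab D1 v" "\<And>v. flab ?G (Rt v) = flab D2 v"
    "\<And>v. flab ?G (Ncc v) = LCc" "\<And>v. flab ?G (Nct v) = LCtr"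
    "\<And>x. fup ?G (Lf x) = (case fup D1 x of Some v \<Rightarrow> Some (Lf v)
        | None \<Rightarrow> Some (Ncc (THE y. y \<in> set (labs X) \<and> u1 y = x)))"
    "\<And>x. fup ?G (Rt x) = (case fup D2 x of Some v \<Rightarrow> Some (Rt v)
        | None \<Rightarrow> Some (Ncc (THE y. y \<in> set (labs X) \<and> u2 y = x)))"
    "\<And>x. fup ?G (NU x) = None" "\<And>x. fup ?G (NL x) = Some (Nct x)"
    "\<And>x. x \<noteq> g3 \<Longrightarrow> flo ?G (Lf x) = (case flo D1 x of Some v \<Rightarrow> Some (Lf v)
        | None \<Rightarrow> Some (Nct (THE y. y \<in> set (labs Y) \<and> l1 y = x)))"
    "\<And>x. flo ?G (right_label x) = (case flo D2 x of Some v \<Rightarrow> Some (Rt v)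
        | None \<Rightarrow> Some (Nct (THE y. y \<in> set (labs Y) \<and> l2 y = x)))"
    "\<And>x. flo ?G (NU x) = Some (Ncc x)" "\<And>x. flo ?G (NL x) = None"
    unfolding glue_def Let_def upB loB u1_def u2_def l1_def l2_def right_label_def g2_def g3_def
    by simp_all auto
  note R1 = realizesD[OF D1] and R2 = realizesD[OF D2]
  have inj: "inj_on u1 (set (labs X))" "inj_on u2 (set (labs X))"
    "inj_on l1 (set (labs Y))" "inj_on l2 (set (labs Y))"
    using distinct_left distinct_right by (simp_all only: distinct_append distinct_map)
  have vs: "map fst glued_events = map Ncc (labs X) @ map Lf (map fst es1) @
      map Rt (map fst es2) @ map Nct (labs Y)"
    by (simp add: glued_events_def comp_def)
  have c: "inj_on Ncc A" "inj_on Nct A" "inj_on Lf A" "inj_on Rt A" "inj_on NU A" "inj_on NL A" for A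
    by (simp_all add: inj_on_def)
  have dd: "distinct (map c xs) \<longleftrightarrow> distinct xs" if "\<And>A. inj_on c A" for c and xs :: "nm list"
    using that by (simp add: distinct_map)
  note dd = c[THEN dd]
  show ?thesis
    unfolding realizes_def
  proof (intro conjI)
    show "distinct (map fst glued_events)"
      unfolding vs distinct_append dd set_append using distX distY R1(1) R2(1) by auto
    show "fV ?G = set (map fst glued_events)"
      unfolding vs G(1) R1(2) R2(2) set_append set_map[of Ncc] set_map[of Lf] set_map[of Rt] set_map[of Nct]
      by blast
    have lab: "labs (relab NU X) @ outs glued_events = map NU (labs X) @ outs glued_events" by simp
    have "distinct (map NU (labs X) @
     map Lf (map u1 (labs X) @ outs es1) @ map Rt (map u2 (labs X) @ outs es2) @ map NL (labs Y))"
      unfolding distinct_append[of "map NU _"] distinct_append[of "map Lf _"]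
        distinct_append[of "map Rt _"] dd
      using distX distY distinct_left(1) distinct_right(1) by auto
    then show "distinct (labs (relab NU X) @ outs glued_events)"
      unfolding lab using mset_eq_imp_distinct_iff[OF mset_glued_labels] by blast
    have E: "fE D1 = set (map u1 (labs X) @ outs es1)" using R1(4) by (simp add: comp_def)
    have "fE D2 = insert g2 (set (map u2 (labs X) @ outs es2))" using R2(4) by (auto simp: comp_def)
    moreover have "g2 \<notin> set (map u2 (labs X) @ outs es2)" using distinct_right(1) by auto
    ultimately have "fE D2 - {g2} = set (map u2 (labs X) @ outs es2)" by blast
    then show "fE ?G = set (labs (relab NU X) @ outs glued_events)"
      unfolding lab mset_eq_setD[OF mset_glued_labels] G(2) E
      by (simp only: set_append set_map[of Lf] set_map[of Rt] set_map[of NU] set_map[of NL]) blast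
    show "\<forall>x\<in>set (labs (relab NU X)). fup ?G x = None" by (auto simp: G)
    show "\<forall>x\<in>set (labs (relab NL Y)). flo ?G x = None" by (auto simp: G)
    have up: "fup D1 (u1 x) = None" "fup D2 (u2 x) = None" if "x \<in> set (labs X)" for x
      using R1(5)[of "u1 x"] R2(5)[of "u2 x"] that by auto
    have lo: "flo D1 (l1 x) = None" "flo D2 (l2 x) = None" "l1 x \<noteq> g3" if "x \<in> set (labs Y)" for x
      using R1(6)[of "l1 x"] R2(6)[of "l2 x"] that distinct_left(2) by auto
    have g3: "flo D1 g3 = None" using R1(6)[of g3] by simp
    show "\<forall>(v, l, i, out)\<in>set glued_events. flab ?G v = l \<and>
        (\<forall>x\<in>set i. flo ?G x = Some v) \<and> (\<forall>x\<in>set out. fup ?G x = Some v)"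
    proof (clarify)
      fix v l i out assume "(v, l, i, out) \<in> set glued_events"
      then consider
          x where "x \<in> set (labs X)" "(v, l, i, out) = (Ncc x, LCc, [NU x], [Lf (u1 x), right_label (u2 x)])"
        | v' i' out' where "(v', l, i', out') \<in> set es1" "v = Lf v'" "i = map Lf i'" "out = map Lf out'"
        | v' i' out' where "(v', l, i', out') \<in> set es2" "v = Rt v'" "i = map right_label i'" "out = map right_label out'"
        | x where "x \<in> set (labs Y)" "(v, l, i, out) = (Nct x, LCtr, [Lf (l1 x), right_label (l2 x)], [NL x])"
        unfolding glued_events_def by (auto simp del: map_map set_atoms) force+
      then show "flab ?G v = l \<and> (\<forall>x\<in>set i. flo ?G x = Some v) \<and> (\<forall>x\<in>set out. fup ?G x = Some v)"
      proof cases
        case (1 x)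
        then show ?thesis using up THE_inj[OF inj(1)] THE_inj[OF inj(2)] right_label_Rt(1)
          by (simp add: G del: set_map)
      next
        case (2 v' i' out')
        note ev = realizes_event[OF D1 2(1)]
        \<comment> \<open>As a lower edge of \<open>D1\<close>, \<open>g3\<close> enters none of its
          events, so its redirected lower end does no harm.\<close>
        have "x \<noteq> g3" if "x \<in> set i'" for x using ev(3)[OF that] g3 by auto
        then show ?thesis using 2 ev by (simp add: G)
      next
        case (3 v' i' out')
        note ev = realizes_event[OF D2 3(1)]
        have "right_label x = Rt x" if "x \<in> set out'" for x
          using that 3(1) right_label_Rt(2) in_outs by metis
        then show ?thesis using 3 ev by (simp add: G)
      next
        case (4 x)
        then show ?thesis using lo THE_inj[OF inj(3)] THE_inj[OF inj(4)]
          by (simp add: G del: set_map)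
      qed
    qed
  qed
qed

end

section \<open>Soundness\<close>

text \<open>The form in which soundness can be proved by induction: it covers all premisses and
  conclusions, and \<open>fu\<close>, \<open>fl\<close> prescribe the edge at each of their
  occurrences.\<close>

definition sound_reduct :: "('a \<Rightarrow> 'a) \<Rightarrow> (nm, nm) flow \<Rightarrow> (nm, nm) flow \<Rightarrow> (nm \<Rightarrow> nm) \<Rightarrow> (nm \<Rightarrow> nm) \<Rightarrow> bool"
  where "sound_reduct bar B C fu fl \<longleftrightarrow> (\<forall>X es Y. derives bar X es Y \<longrightarrow> realizes B X es Y \<longrightarrow>
    (\<exists>es'. derives bar (relab fu X) es' (relab fl Y) \<and> realizes C (relab fu X) es' (relab fl Y)))"

lemma sound_reduct_refl: "sound_reduct bar B B id id"
  unfolding sound_reduct_def by (simp only: relab_id) blast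

lemma sound_reduct_glue:
  assumes inv: "\<forall>a. bar (bar a) = a" and simple: "simple_edge B e"
    and L: "sound_reduct bar (splitL B e) D1 fu1 fl1"
    and R: "sound_reduct bar (splitR B e) D2 fu2 fl2"
  shows "sound_reduct bar B (glue B e D1 fu1 fl1 D2 fu2 fl2) NU NL"
  unfolding sound_reduct_def
proof (intro allI impI)
  fix X Y :: "('a \<times> nm) fm" and es :: "(nm, nm) event list"
  assume d: "derives bar X es Y" and B: "realizes B X es Y"
  obtain es1 es2 es3 i k o1 i1 c1 c2 a e2 e3 where
    es: "es = es1 @ (i, LInt, [], o1) # es2 @ (k, LCut, i1, []) # es3"
    and o1: "o1 = [e, e2] \<or> o1 = [e2, e]" and i1: "i1 = [e, e3] \<or> i1 = [e3, e]"
    and up: "fup B e = Some i" and lo: "flo B e = Some k"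
    and d1: "derives bar X es1 (fill c1 TT)"
    and d2: "derives bar (fill c1 (Or (At (a, e)) (At (bar a, e2)))) es2
      (fill c2 (And (At (a, e)) (At (bar a, e3))))"
    and d3: "derives bar (fill c2 FF) es3 Y"
    and fresh: "e \<notin> set (ctx_labs c1)" "e \<notin> set (ctx_labs c2)" "e \<noteq> e2" "e \<noteq> e3"
      "e \<notin> set (ins es2)" "e \<notin> set (outs es2)"
    using simple_edge_decompose[OF inv d B simple] .
  note split = B d es o1 i1 up lo
  let ?T = "map (relab_event Tl Tl)" and ?H = "map (relab_event Ht Ht)"
  have "derives bar (relab Tl X) (?T es1 @ (Nw, LW, [], [Tl e2]) # ?T es2 @ ?T es3)
      (Or (relab Tl Y) (At (bar a, Tl e3)))"
    by (rule left_derivation[of bar _ _ "map_ctx (apsnd Tl) c1" a "Tl e" _ _ _ "map_ctx (apsnd Tl) c2"])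
      (use derives_relab[OF d1, of Tl Tl] derives_relab[OF d2, of Tl Tl] derives_relab[OF d3, of Tl Tl] fresh
        in \<open>auto simp: image_iff\<close>)
  from L[unfolded sound_reduct_def, rule_format, OF this realizes_splitL[OF split]]
  obtain es1' where L': "derives bar (relab (\<lambda>x. fu1 (Tl x)) X) es1'
      (Or (relab (\<lambda>x. fl1 (Tl x)) Y) (At (bar a, fl1 (Tl (e3_of B e)))))"
    "realizes D1 (relab (\<lambda>x. fu1 (Tl x)) X) es1'
      (Or (relab (\<lambda>x. fl1 (Tl x)) Y) (At (bar a, fl1 (Tl (e3_of B e)))))"
    by (auto simp: e3_of_eq[OF split])
  have "derives bar (And (relab Ht X) (At (bar a, Ht e2))) (?H es1 @ ?H es2 @ (Ncw, LCw, [Ht e3], []) # ?H es3)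
      (relab Ht Y)"
    by (rule right_derivation[of bar _ _ "map_ctx (apsnd Ht) c1" a "Ht e" _ _ _ "map_ctx (apsnd Ht) c2"])
      (use derives_relab[OF d1, of Ht Ht] derives_relab[OF d2, of Ht Ht] derives_relab[OF d3, of Ht Ht] fresh
        in \<open>auto simp: image_iff\<close>)
  from R[unfolded sound_reduct_def, rule_format, OF this realizes_splitR[OF split]]
  obtain es2' where R': "derives bar (And (relab (\<lambda>x. fu2 (Ht x)) X) (At (bar a, fu2 (Ht (e2_of B e))))) es2'
      (relab (\<lambda>x. fl2 (Ht x)) Y)"
    "realizes D2 (And (relab (\<lambda>x. fu2 (Ht x)) X) (At (bar a, fu2 (Ht (e2_of B e))))) es2'
      (relab (\<lambda>x. fl2 (Ht x)) Y)"
    by (auto simp: e2_of_eq[OF split])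
  have dist: "distinct (labs X)" "distinct (labs Y)"
    using realizesD(3)[OF B] derives_labels(2)[OF d] by auto
  note glue = upper_realizes[OF B] lower_realizes[OF B d] dist L'(2,1) R'(2,1)
  show "\<exists>es'. derives bar (relab NU X) es' (relab NL Y) \<and>
      realizes (glue B e D1 fu1 fl1 D2 fu2 fl2) (relab NU X) es' (relab NL Y)"
    using derives_glue[OF glue] realizes_glue[OF glue] by blast
qed

lemma red_bc_sound:
  "red_bc B C fu fl \<Longrightarrow> \<forall>a. bar (bar a) = a \<Longrightarrow> sound_reduct bar B C fu fl"
  by (induction rule: red_bc.induct) (simp_all add: sound_reduct_refl sound_reduct_glue)

lemma red_ex_sound:
  "red_ex B C fu fl \<Longrightarrow> \<forall>a. bar (bar a) = a \<Longrightarrow> sound_reduct bar B C fu fl"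
proof (induction rule: red_ex.induct)
  case (ex_step B e D1 fu1 fl1 D2 fu2 fl2)
  then have "simple_edge B e" by (auto simp: extremal_def)
  then show ?case using ex_step by (simp add: sound_reduct_glue)
qed (simp add: sound_reduct_refl)

theorem theorem5p13:
  fixes bar :: "'a \<Rightarrow> 'a" and x :: "'a fm" and \<Phi> :: "('a ctx \<times> 'a inst) list"
    and B C :: "(nm, nm) flow" and R :: "(nm, nm) flow \<Rightarrow> (nm, nm) flow \<Rightarrow> bool"
  assumes "\<forall>a. bar (bar a) = a" and "\<forall>a. bar a \<noteq> a"
    and "R = to_bc \<or> R = to_ex"
    and "R B C"
    and "derivation bar x \<Phi>"
    and "flow_iso (dflow bar x \<Phi>) B"
  shows "\<exists>\<Psi>. derivation bar x \<Psi> \<and> dconcl bar x \<Psi> = dconcl bar x \<Phi>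
            \<and> flow_iso (dflow bar x \<Psi>) C"
proof -
  obtain fu fl where sound: "sound_reduct bar B C fu fl"
    using assms(1,3,4) red_bc_sound red_ex_sound unfolding to_bc_def to_ex_def by blast
  obtain X es Y where d: "lder bar \<Phi> X es Y" and F: "realizes (dflow bar x \<Phi>) X es Y"
    and X: "map_fm fst X = x" and Y: "map_fm fst Y = dconcl bar x \<Phi>"
    using dflow_realized[OF assms(5)] by blast
  obtain fv fe where iso: "bij_betw fv (fV (dflow bar x \<Phi>)) (fV B)"
    "bij_betw fe (fE (dflow bar x \<Phi>)) (fE B)"
    "\<forall>v \<in> fV (dflow bar x \<Phi>). flab B (fv v) = flab (dflow bar x \<Phi>) v"
    "\<forall>e \<in> fE (dflow bar x \<Phi>). fup B (fe e) = map_option fv (fup (dflow bar x \<Phi>) e)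
       \<and> flo B (fe e) = map_option fv (flo (dflow bar x \<Phi>) e)"
    using assms(6) unfolding flow_iso_def by blast
  \<comment> \<open>The decoration is moved from the traced edges of the given derivation to the
    names of \<open>B\<close>, on which the reduction acts.\<close>
  have "derives bar (relab fe X) (map (relab_event fv fe) es) (relab fe Y)"
    using lder_relab[OF d] unfolding derives_def by blast
  with sound realizes_transfer[OF d F iso] obtain es' \<Psi>
    where d': "lder bar \<Psi> (relab fu (relab fe X)) es' (relab fl (relab fe Y))"
      and C: "realizes C (relab fu (relab fe X)) es' (relab fl (relab fe Y))"
    unfolding sound_reduct_def derives_def by blast
  have \<Psi>: "derivation bar x \<Psi>" "dconcl bar x \<Psi> = dconcl bar x \<Phi>"
    using lder_derivation[OF d'] X Y by (simp_all del: relab_relab)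
  \<comment> \<open>A second decoration of \<open>\<Psi>\<close>, by its own traced edges; comparing
    it with the one by edges of \<open>C\<close> gives the isomorphism.\<close>
  obtain X2 es2 Y2 where d2: "lder bar \<Psi> X2 es2 Y2" and F2: "realizes (dflow bar x \<Psi>) X2 es2 Y2"
    and X2: "map_fm fst X2 = x"
    using dflow_realized[OF \<Psi>(1)] by blast
  have "flow_iso (dflow bar x \<Psi>) C"
    by (rule realizes_unique[OF d2 F2 d' C]) (simp add: X X2)
  with \<Psi> show ?thesis by blast
qed

end
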